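(* Let $(R,\mathfrak m)$ be an $F$-finite noetherian local ring of characteristic $p>0$ and dimension $d\ge2$, and let $I$ be an $\mathfrak m$-primary ideal of $R$. Then there exists $q_0$ such that for all powers $q$ of $p$ with $q\ge q_0$, $I^{q+1}\nsubseteq(I^{[q]})^*$.
   Context: $F$-finite means the Frobenius endomorphism is finite. $I^{[q]}$ is the ideal generated by $q$-th powers of elements of $I$. The tight closure $\mathfrak a^*$ of an ideal $\mathfrak a$ is the ideal of all $x\in R$ for which there is $c\in R$, not in any minimal prime of $R$, with $cx^{p^n}\in\mathfrak a^{[p^n]}$ for all large $n$. *)

theory Defs
  imports
    "HOL-Algebra.Ideal_Product"
    "HOL-Algebra.Ring_Divisibility"
    "HOL-Library.Extended_Nat"
    "HOL-Computational_Algebra.Primes"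
begin

text \<open>The characteristic is the nonnegative generator of the kernel of the canonical map from the
  integers to \<open>R\<close>.\<close>

definition has_characteristic :: "('a, 'b) ring_scheme \<Rightarrow> nat \<Rightarrow> bool" where
  "has_characteristic R p \<longleftrightarrow> (\<forall>k::nat. add_pow R k \<one>\<^bsub>R\<^esub> = \<zero>\<^bsub>R\<^esub> \<longleftrightarrow> p dvd k)"

definition local_ring :: "('a, 'b) ring_scheme \<Rightarrow> 'a set \<Rightarrow> bool" where
  "local_ring R \<mm> \<longleftrightarrow> cring R \<and> {J. maximalideal J R} = {\<mm>}"

text \<open>The supremum of the lengths \<open>n\<close> of chains \<open>P\<^sub>0 \<subset> \<dots> \<subset> P\<^sub>n\<close> of prime ideals; the zero ring,
  which has no prime ideal, gets dimension 0.\<close>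

definition krull_dim :: "('a, 'b) ring_scheme \<Rightarrow> enat" where
  "krull_dim R = Sup {enat n |n. \<exists>P. (\<forall>i\<le>n. primeideal (P i) R) \<and> (\<forall>i<n. P i \<subset> P (Suc i))}"

definition minimal_prime :: "('a, 'b) ring_scheme \<Rightarrow> 'a set \<Rightarrow> bool" where
  "minimal_prime R P \<longleftrightarrow> primeideal P R \<and> (\<forall>Q. primeideal Q R \<and> Q \<subseteq> P \<longrightarrow> Q = P)"

definition radical :: "('a, 'b) ring_scheme \<Rightarrow> 'a set \<Rightarrow> 'a set" where
  "radical R I = {x \<in> carrier R. \<exists>n::nat. x [^]\<^bsub>R\<^esub> n \<in> I}"

definition primary_ideal :: "('a, 'b) ring_scheme \<Rightarrow> 'a set \<Rightarrow> bool" where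
  "primary_ideal R I \<longleftrightarrow> ideal I R \<and> I \<noteq> carrier R \<and>
     (\<forall>x\<in>carrier R. \<forall>y\<in>carrier R. x \<otimes>\<^bsub>R\<^esub> y \<in> I \<longrightarrow> x \<in> I \<or> y \<in> radical R I)"

text \<open>An ideal is \<open>P\<close>-primary if it is primary with radical \<open>P\<close>.\<close>

definition primary_to :: "('a, 'b) ring_scheme \<Rightarrow> 'a set \<Rightarrow> 'a set \<Rightarrow> bool" where
  "primary_to R P I \<longleftrightarrow> primary_ideal R I \<and> radical R I = P"

text \<open>A ring homomorphism \<open>h : R \<rightarrow> S\<close> is finite if \<open>S\<close> is finitely generated as an \<open>R\<close>-module,
  where \<open>r\<close> acts on \<open>S\<close> as multiplication by \<open>h r\<close>.\<close>

definition finite_ring_hom ::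
  "('a, 'b) ring_scheme \<Rightarrow> ('c, 'd) ring_scheme \<Rightarrow> ('a \<Rightarrow> 'c) \<Rightarrow> bool" where
  "finite_ring_hom R S h \<longleftrightarrow> h \<in> ring_hom R S \<and>
     (\<exists>B. finite B \<and> B \<subseteq> carrier S \<and>
        (\<forall>s\<in>carrier S. \<exists>a\<in>B \<rightarrow> carrier R. s = (\<Oplus>\<^bsub>S\<^esub>b\<in>B. h (a b) \<otimes>\<^bsub>S\<^esub> b)))"

text \<open>For a ring \<open>R\<close> of prime characteristic \<open>p\<close>.\<close>

definition F_finite :: "nat \<Rightarrow> ('a, 'b) ring_scheme \<Rightarrow> bool" where
  "F_finite p R \<longleftrightarrow> finite_ring_hom R R (\<lambda>x. x [^]\<^bsub>R\<^esub> p)"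

text \<open>The ideal \<open>I\<^sup>[\<^sup>q\<^sup>]\<close>, not to be confused with the ordinary power
  \<open>I [^]\<^bsub>ideals_set R\<^esub> q\<close>.\<close>

definition bracket_power :: "('a, 'b) ring_scheme \<Rightarrow> 'a set \<Rightarrow> nat \<Rightarrow> 'a set" where
  "bracket_power R I q = Idl\<^bsub>R\<^esub> {x [^]\<^bsub>R\<^esub> q |x. x \<in> I}"

definition tight_closure :: "nat \<Rightarrow> ('a, 'b) ring_scheme \<Rightarrow> 'a set \<Rightarrow> 'a set" where
  "tight_closure p R \<aa> = {x \<in> carrier R. \<exists>c\<in>carrier R. (\<forall>P. minimal_prime R P \<longrightarrow> c \<notin> P) \<and>
     (\<forall>\<^sub>F n in sequentially. c \<otimes>\<^bsub>R\<^esub> x [^]\<^bsub>R\<^esub> (p ^ n) \<in> bracket_power R \<aa> (p ^ n))}"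

end

theory Submission
  imports Defs "HOL-Library.List_Lexorder"
begin

text \<open>Suppose \<open>I^(q+1)\<close> lies in the tight closure of \<open>I^[q]\<close> for a large \<open>q\<close>. Let \<open>I\<close> be generated by \<open>\<mu>\<close>
  elements and let \<open>P\<close> be the bottom of a prime chain of length \<open>d\<close>, hence a minimal prime. A common
  multiplier \<open>c \<notin> P\<close> for the finitely many monomials of degree \<open>q + 1\<close> in the generators gives
  \<open>c I^((q+\<mu>)u) \<subseteq> I^[qu]\<close> for all large powers \<open>u\<close> of \<open>p\<close>. Write \<open>L n\<close> for the length of \<open>R / (P + I^n)\<close>.
  As \<open>I^[qu]\<close> has only \<open>\<mu>\<close> generators and \<open>c\<close> is harmless by Artin-Rees modulo the prime \<open>P\<close>, comparing
  lengths modulo \<open>I^(qu+s)\<close> yields \<open>L (qu + s - k) \<le> L ((q + \<mu>) u) + \<mu> L s\<close> for a constant \<open>k\<close>. The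
  increments \<open>h\<close> of \<open>L\<close> are eventually nondecreasing, so \<open>s = 2\<mu>u + k\<close> gives \<open>h (qu) \<le> C h (Cu)\<close>, where
  \<open>C\<close> depends only on \<open>\<mu>\<close> and \<open>p\<close>. Iterated over powers of \<open>p\<close> with \<open>q > C^2\<close>, this bounds \<open>h n\<close> along a
  sequence by a power of \<open>n\<close> with exponent below 1, whereas \<open>d \<ge> 2\<close> forces \<open>h\<close> to grow at least linearly.\<close>

section \<open>Exponent vectors\<close>

text \<open>No Hilbert polynomial is formed: only the eventual monotonicity of \<open>h\<close> and
  the bound \<open>n + L (n - k) \<le> L n\<close> are used. Monotonicity comes from splitting each
  graded piece by monomials in lexicographic order; the same leading coefficient ideals, with
  Dickson's lemma, give Artin-Rees. Linear growth uses two strict inclusions above P: for x in the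
  next prime P1 but not in P, the quotient by P + I^n + xR surjects onto R / (P1 + I^n), of length
  at least n since I is not inside P1. The constant C depends on \<mu> and p only, whereas c, k and
  the threshold for u depend on q. Hence q stays fixed and the bound is iterated along u: each round
  multiplies the index by q/C and \<open>h\<close> by at most C, which is sublinear exactly when q >
  C^2.\<close>

definition exps :: "nat \<Rightarrow> nat \<Rightarrow> nat list set" where
  "exps r n = {\<alpha>. length \<alpha> = r \<and> sum_list \<alpha> = n}"

lemma finite_exps: "finite (exps r n)"
proof (rule finite_subset)
  show "exps r n \<subseteq> {\<alpha>. set \<alpha> \<subseteq> {..n} \<and> length \<alpha> = r}"
    by (auto simp: exps_def dest: member_le_sum_list)
qed (simp add: finite_lists_length_eq)

lemma exps_zero: "exps 0 n = (if n = 0 then {[]} else {})"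
  by (auto simp: exps_def)

lemma exps_Suc: "exps (Suc r) n = (\<Union>i\<le>n. Cons i ` exps r (n - i))"
  by (auto simp: exps_def length_Suc_conv image_iff)

abbreviation exp_add :: "nat list \<Rightarrow> nat list \<Rightarrow> nat list" where
  "exp_add \<equiv> map2 (+)"

abbreviation exp_le :: "nat list \<Rightarrow> nat list \<Rightarrow> bool" where
  "exp_le \<equiv> list_all2 (\<le>)"

lemma sum_list_exp_add:
  "length \<alpha> = length \<beta> \<Longrightarrow> sum_list (exp_add \<alpha> \<beta>) = sum_list \<alpha> + sum_list \<beta>"
  by (induction \<alpha> \<beta> rule: list_induct2) auto

text \<open>This makes the lexicographic order on vectors of one fixed length a monomial order;
  every cancellation of leading terms relies on it.\<close>

lemma exp_add_less_mono:
  assumes "\<alpha> < \<beta>" "length \<alpha> = length \<beta>" "length \<gamma> = length \<beta>"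
  shows "exp_add \<alpha> \<gamma> < exp_add \<beta> \<gamma>"
  using assms(2,3,1)
proof (induction \<alpha> \<beta> arbitrary: \<gamma> rule: list_induct2)
  case (Cons x xs y ys)
  then show ?case by (cases \<gamma>) auto
qed simp

lemma exp_le_imp_exp_add:
  assumes "exp_le \<beta> \<alpha>"
  obtains \<gamma> where "length \<gamma> = length \<alpha>" "\<alpha> = exp_add \<beta> \<gamma>"
proof -
  have "\<exists>\<gamma>. length \<gamma> = length \<alpha> \<and> \<alpha> = exp_add \<beta> \<gamma>"
    using assms
  proof (induction \<beta> \<alpha> rule: list_all2_induct)
    case (Cons x xs y ys)
    then obtain \<gamma> where "length \<gamma> = length ys" "ys = exp_add xs \<gamma>" by blast
    then show ?case
      using Cons.hyps by (intro exI[of _ "(y - x) # \<gamma>"]) auto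
  qed simp
  with that show ?thesis by blast
qed

lemma exp_truncate:
  assumes "m \<le> sum_list (\<alpha> :: nat list)"
  obtains \<beta> where "exp_le \<beta> \<alpha>" "sum_list \<beta> = m"
proof -
  have "\<exists>\<beta>. exp_le \<beta> \<alpha> \<and> sum_list \<beta> = m"
    using assms
  proof (induction \<alpha> arbitrary: m)
    case (Cons a \<alpha>)
    show ?case
    proof (cases "m \<le> sum_list \<alpha>")
      case True
      with Cons.IH obtain \<beta> where "exp_le \<beta> \<alpha>" "sum_list \<beta> = m" by blast
      then show ?thesis by (intro exI[of _ "0 # \<beta>"]) simp
    next
      case False
      with Cons.prems show ?thesis
        by (intro exI[of _ "(m - sum_list \<alpha>) # \<alpha>"]) (auto simp: list_all2_refl)
    qed
  qed simp
  with that show thesis by blast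
qed

lemma exp_add_div_mod:
  "exp_add (map (\<lambda>i. i * u) (map (\<lambda>i. i div u) \<beta>)) (map (\<lambda>i. i mod u) \<beta>) = (\<beta> :: nat list)"
  by (induction \<beta>) auto

text \<open>Remainders are at most u - 1. The unit saved per entry, \<open>length \<beta>\<close> on
  the left, later turns a weak inequality into a strict one.\<close>

lemma sum_list_le_div:
  assumes "0 < (u::nat)"
  shows "sum_list \<beta> + length \<beta> \<le> u * sum_list (map (\<lambda>i. i div u) \<beta>) + length \<beta> * u"
proof (induction \<beta>)
  case (Cons b \<beta>)
  have "Suc (b mod u) \<le> u" using assms by (simp add: Suc_leI)
  then have "b + 1 \<le> u * (b div u) + u"
    using mult_div_mod_eq[of u b] by linarith
  with Cons show ?case by (simp add: algebra_simps)
qed simp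

section \<open>Dickson's lemma and well-founded invariants of exponent vectors\<close>

lemma nondecreasing_subsequence_nat:
  fixes f :: "nat \<Rightarrow> nat"
  obtains \<phi> :: "nat \<Rightarrow> nat"
  where "strict_mono \<phi>" "\<And>i j. i \<le> j \<Longrightarrow> f (\<phi> i) \<le> f (\<phi> j)"
proof -
  obtain \<phi> :: "nat \<Rightarrow> nat" where \<phi>: "strict_mono \<phi>" "monoseq (\<lambda>n. f (\<phi> n))"
    using seq_monosub[of f] by blast
  show ?thesis
  proof (cases "\<forall>m n. m \<le> n \<longrightarrow> f (\<phi> m) \<le> f (\<phi> n)")
    case True
    with \<phi>(1) show ?thesis by (intro that[of \<phi>]) auto
  next
    case False
    then have dec: "m \<le> n \<Longrightarrow> f (\<phi> n) \<le> f (\<phi> m)" for m n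
      using \<phi> by (auto simp: monoseq_def)
    \<comment> \<open>A nonincreasing sequence of naturals is constant from an index of its minimum
      on.\<close>
    obtain i where i: "\<And>j. f (\<phi> i) \<le> f (\<phi> j)"
      using ex_has_least_nat[of "\<lambda>_. True" 0 "\<lambda>n. f (\<phi> n)"] by auto
    have "f (\<phi> (i + a)) = f (\<phi> i)" for a
      using i[of "i + a"] dec[of i "i + a"] by simp
    with \<phi> show ?thesis
      by (intro that[of "\<lambda>n. \<phi> (i + n)"]) (auto simp: strict_mono_def)
  qed
qed

text \<open>Sort the first entries along a subsequence, then refine it for the tails by induction;
  refinement keeps the first entries sorted.\<close>

lemma dickson:
  fixes s :: "nat \<Rightarrow> nat list"
  assumes "\<And>n. length (s n) = r"
  obtains \<phi> :: "nat \<Rightarrow> nat" where "strict_mono \<phi>" "\<And>i j. i \<le> j \<Longrightarrow> exp_le (s (\<phi> i)) (s (\<phi> j))"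
proof -
  have "\<exists>\<phi> :: nat \<Rightarrow> nat. strict_mono \<phi> \<and> (\<forall>i j. i \<le> j \<longrightarrow> exp_le (s (\<phi> i)) (s (\<phi> j)))"
    using assms
  proof (induction r arbitrary: s)
    case 0
    then show ?case by (intro exI[of _ id]) (auto simp: strict_mono_def)
  next
    case (Suc r)
    obtain \<phi> :: "nat \<Rightarrow> nat" where \<phi>: "strict_mono \<phi>" "\<And>i j. i \<le> j \<Longrightarrow> hd (s (\<phi> i)) \<le> hd (s (\<phi> j))"
      using nondecreasing_subsequence_nat[of "\<lambda>n. hd (s n)"] by blast
    obtain \<psi> :: "nat \<Rightarrow> nat" where \<psi>: "strict_mono \<psi>"
      "\<And>i j. i \<le> j \<Longrightarrow> exp_le (tl (s (\<phi> (\<psi> i)))) (tl (s (\<phi> (\<psi> j))))"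
      using Suc.IH[of "\<lambda>n. tl (s (\<phi> n))"] Suc.prems by auto
    have "exp_le (s (\<phi> (\<psi> i))) (s (\<phi> (\<psi> j)))" if "i \<le> j" for i j
    proof -
      have ne: "s n = hd (s n) # tl (s n)" for n
        using Suc.prems[of n] by (cases "s n") auto
      have "\<psi> i \<le> \<psi> j" using \<psi>(1) that by (simp add: strict_mono_less_eq)
      with \<phi>(2) \<psi>(2)[OF that] show ?thesis
        by (subst ne, subst (3) ne) simp
    qed
    moreover have "strict_mono (\<lambda>n. \<phi> (\<psi> n))"
      using \<phi>(1) \<psi>(1) by (simp add: strict_mono_def)
    ultimately show ?case by blast
  qed
  with that show ?thesis by blast
qed

text \<open>Otherwise every degree bound has a counterexample, and Dickson's lemma finds an
  increasing sequence of them along which \<open>T\<close> descends forever. The general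
  \<open>rel\<close> serves two uses: natural numbers under \<open>less_than\<close>, and ideals
  under reverse inclusion.\<close>

lemma finite_basis:
  fixes T :: "nat list \<Rightarrow> 'x"
  assumes "wf rel"
    and step: "\<And>\<alpha> \<beta>. length \<alpha> = r \<Longrightarrow> exp_le \<beta> \<alpha> \<Longrightarrow> T \<beta> = T \<alpha> \<or> (T \<alpha>, T \<beta>) \<in> rel"
  obtains k where
    "\<And>\<alpha>. length \<alpha> = r \<Longrightarrow> \<exists>\<beta>. exp_le \<beta> \<alpha> \<and> sum_list \<beta> \<le> k \<and> T \<beta> = T \<alpha>"
proof (rule ccontr)
  assume "\<not> thesis"
  with that have "\<forall>k. \<exists>\<alpha>. length \<alpha> = r \<and> (\<forall>\<beta>. exp_le \<beta> \<alpha> \<longrightarrow> sum_list \<beta> \<le> k \<longrightarrow> T \<beta> \<noteq> T \<alpha>)"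
    by blast
  then obtain f where f: "\<And>k. length (f k) = r"
    "\<And>k \<beta>. exp_le \<beta> (f k) \<Longrightarrow> sum_list \<beta> \<le> k \<Longrightarrow> T \<beta> \<noteq> T (f k)"
    by metis
  \<comment> \<open>\<open>\<kappa>\<close> jumps past the degree of the previous counterexample, so
    each one is an admissible \<beta> for all later ones above it, and \<open>T\<close> must
    differ.\<close>
  define \<kappa> where "\<kappa> = rec_nat 0 (\<lambda>_ k. k + sum_list (f k))"
  have \<kappa>_Suc: "\<kappa> (Suc n) = \<kappa> n + sum_list (f (\<kappa> n))" for n
    by (simp add: \<kappa>_def)
  then have mono: "i \<le> j \<Longrightarrow> \<kappa> i \<le> \<kappa> j" for i j
    by (metis lift_Suc_mono_le le_add1)
  have bad: "T (f (\<kappa> i)) \<noteq> T (f (\<kappa> j))" if "i < j" "exp_le (f (\<kappa> i)) (f (\<kappa> j))" for i j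
  proof (rule f(2)[OF that(2)])
    show "sum_list (f (\<kappa> i)) \<le> \<kappa> j"
      using mono[of "Suc i" j] that(1) by (simp add: \<kappa>_Suc)
  qed
  obtain \<phi> :: "nat \<Rightarrow> nat" where \<phi>: "strict_mono \<phi>"
    "\<And>i j. i \<le> j \<Longrightarrow> exp_le (f (\<kappa> (\<phi> i))) (f (\<kappa> (\<phi> j)))"
    using dickson[of "\<lambda>n. f (\<kappa> n)" r] f(1) by blast
  have "(T (f (\<kappa> (\<phi> (Suc i)))), T (f (\<kappa> (\<phi> i)))) \<in> rel" for i
  proof -
    have "\<phi> i < \<phi> (Suc i)" using \<phi>(1) by (simp add: strict_mono_def)
    then show ?thesis
      using step[OF f(1) \<phi>(2)[of i "Suc i"]] bad \<phi>(2)[of i "Suc i"] by force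
  qed
  with \<open>wf rel\<close> show False
    unfolding wf_iff_no_infinite_down_chain
    by (auto dest!: spec[of _ "\<lambda>i. T (f (\<kappa> (\<phi> i)))"])
qed

text \<open>Slicing by the first exponent, all slices from some index on coincide and contribute the
  partial sums of a fixed series; the finitely many others are covered by induction.\<close>

lemma eventually_mono_sum_exps:
  fixes g :: "nat list \<Rightarrow> nat"
  assumes "\<And>\<alpha> \<beta>. length \<alpha> = r \<Longrightarrow> exp_le \<beta> \<alpha> \<Longrightarrow> g \<alpha> \<le> g \<beta>"
  shows "\<exists>n0. \<forall>n\<ge>n0. sum g (exps r n) \<le> sum g (exps r (Suc n))"
  using assms
proof (induction r arbitrary: g)
  case 0
  then show ?case by (intro exI[of _ 1]) (auto simp: exps_zero)
next
  case (Suc r)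
  define G where "G i n = (\<Sum>\<alpha>\<in>exps r n. g (i # \<alpha>))" for i n
  have sum_eq: "sum g (exps (Suc r) n) = (\<Sum>i\<le>n. G i (n - i))" for n
  proof -
    have "sum g (exps (Suc r) n) = (\<Sum>i\<le>n. sum g (Cons i ` exps r (n - i)))"
      unfolding exps_Suc by (rule sum.UNION_disjoint) (auto simp: finite_exps)
    then show ?thesis by (simp add: G_def sum.reindex)
  qed
  obtain k where k:
    "\<And>\<alpha>. length \<alpha> = Suc r \<Longrightarrow> \<exists>\<beta>. exp_le \<beta> \<alpha> \<and> sum_list \<beta> \<le> k \<and> g \<beta> = g \<alpha>"
  proof -
    have "g \<beta> = g \<alpha> \<or> (g \<alpha>, g \<beta>) \<in> less_than" if "length \<alpha> = Suc r" "exp_le \<beta> \<alpha>" for \<alpha> \<beta>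
      using Suc.prems[OF that] by auto
    from finite_basis[where T = g and r = "Suc r", OF wf_less_than this] that show thesis by blast
  qed
  \<comment> \<open>A vector of degree at most k below i # \<alpha> has first entry at most k, so it
    lies below k # \<alpha> too: the degree bound is also the index where slices stabilise.\<close>
  have stable: "g (i # \<alpha>) = g (k # \<alpha>)" if "k \<le> i" "length \<alpha> = r" for i \<alpha>
  proof (rule antisym)
    show "g (i # \<alpha>) \<le> g (k # \<alpha>)"
      using that by (intro Suc.prems) (auto simp: list_all2_refl)
    obtain \<beta> where \<beta>: "exp_le \<beta> (i # \<alpha>)" "sum_list \<beta> \<le> k" "g \<beta> = g (i # \<alpha>)"
      using k[of "i # \<alpha>"] \<open>length \<alpha> = r\<close> by auto
    then have "exp_le \<beta> (k # \<alpha>)" by (cases \<beta>) auto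
    with \<beta>(3) Suc.prems[of "k # \<alpha>" \<beta>] that show "g (k # \<alpha>) \<le> g (i # \<alpha>)" by simp
  qed
  have G_stable: "G i n = G k n" if "k \<le> i" for i n
    unfolding G_def using stable[OF that] by (intro sum.cong) (auto simp: exps_def)
  have "\<forall>i. \<exists>n0. \<forall>n\<ge>n0. G i n \<le> G i (Suc n)"
    unfolding G_def by (intro allI Suc.IH Suc.prems) auto
  then obtain m where m: "\<And>i n. m i \<le> n \<Longrightarrow> G i n \<le> G i (Suc n)" by metis
  define N where "N = k + (\<Sum>i<k. m i)"
  have "(\<Sum>i\<le>n. G i (n - i)) \<le> (\<Sum>i\<le>Suc n. G i (Suc n - i))" if n: "N \<le> n" for n
  proof -
    have split: "(\<Sum>i\<le>a. G i (a - i)) = (\<Sum>i<k. G i (a - i)) + (\<Sum>j\<le>a - k. G k j)"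
      if "k \<le> a" for a
    proof -
      have "(\<Sum>i\<le>a. G i (a - i)) = (\<Sum>i<k. G i (a - i)) + (\<Sum>i=k..a. G i (a - i))"
        using that by (subst sum.union_disjoint[symmetric]) (auto intro: sum.cong)
      also have "(\<Sum>i=k..a. G i (a - i)) = (\<Sum>i=k..a. G k (a - i))"
        by (intro sum.cong) (auto intro: G_stable)
      also have "\<dots> = (\<Sum>j\<le>a - k. G k j)"
        by (rule sum.reindex_bij_witness[of _ "\<lambda>j. a - j" "\<lambda>i. a - i"]) (use that in auto)
      finally show ?thesis .
    qed
    have "(\<Sum>i<k. G i (n - i)) \<le> (\<Sum>i<k. G i (Suc n - i))"
    proof (rule sum_mono)
      fix i assume "i \<in> {..<k}"
      then have "m i \<le> (\<Sum>i<k. m i)" by (intro member_le_sum) auto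
      with n \<open>i \<in> {..<k}\<close> show "G i (n - i) \<le> G i (Suc n - i)"
        using m[of i "n - i"] by (simp add: N_def Suc_diff_le)
    qed
    moreover have "(\<Sum>j\<le>n - k. G k j) \<le> (\<Sum>j\<le>Suc n - k. G k j)"
      by (intro sum_mono2) auto
    ultimately show ?thesis
      using n by (simp only: split[of n] split[of "Suc n"] N_def add_mono)
  qed
  then show ?case unfolding sum_eq by blast
qed

section \<open>Lengths of intervals of ideals\<close>

definition colon :: "('a, 'b) ring_scheme \<Rightarrow> 'a set \<Rightarrow> 'a \<Rightarrow> 'a set" where
  "colon R J c = {x \<in> carrier R. c \<otimes>\<^bsub>R\<^esub> x \<in> J}"

text \<open>The ideal J + cA. With \<open>colon\<close> it realises the isomorphism of R/(J : c)
  with (J + cR)/J on lattices of ideals.\<close>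

definition adjoin :: "('a, 'b) ring_scheme \<Rightarrow> 'a set \<Rightarrow> 'a \<Rightarrow> 'a set \<Rightarrow> 'a set" where
  "adjoin R J c A = {j \<oplus>\<^bsub>R\<^esub> c \<otimes>\<^bsub>R\<^esub> a |j a. j \<in> J \<and> a \<in> A}"

text \<open>\<open>ideal_chain R B n A\<close> says that some chain of ideals from \<open>B\<close> to \<open>A\<close> has at least \<open>n\<close> strict
  inclusions.\<close>

inductive ideal_chain :: "('a, 'b) ring_scheme \<Rightarrow> 'a set \<Rightarrow> nat \<Rightarrow> 'a set \<Rightarrow> bool" for R B where
  start: "ideal B R \<Longrightarrow> ideal_chain R B 0 B"
| strict: "ideal_chain R B n A \<Longrightarrow> A \<subset> A' \<Longrightarrow> ideal A' R \<Longrightarrow> ideal_chain R B (Suc n) A'"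
| weak: "ideal_chain R B n A \<Longrightarrow> A \<subseteq> A' \<Longrightarrow> ideal A' R \<Longrightarrow> ideal_chain R B n A'"

text \<open>Lengths are measured on intervals of ideals of R itself, so no quotient ring is formed.
  The \<open>GREATEST\<close> defining \<open>len\<close> is informative only under this
  predicate.\<close>

definition finite_length :: "('a, 'b) ring_scheme \<Rightarrow> 'a set \<Rightarrow> 'a set \<Rightarrow> bool" where
  "finite_length R B A \<longleftrightarrow> ideal B R \<and> ideal A R \<and> B \<subseteq> A \<and>
     (\<exists>N. \<forall>n. ideal_chain R B n A \<longrightarrow> n \<le> N)"

definition len :: "('a, 'b) ring_scheme \<Rightarrow> 'a set \<Rightarrow> 'a set \<Rightarrow> nat" where
  "len R B A = (GREATEST n. ideal_chain R B n A)"

lemma ideal_chainD: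
  assumes "ideal_chain R B n A"
  shows "ideal B R" "ideal A R" "B \<subseteq> A"
  using assms by (induction rule: ideal_chain.induct) auto

lemma ideal_chain_zero: "ideal B R \<Longrightarrow> ideal A R \<Longrightarrow> B \<subseteq> A \<Longrightarrow> ideal_chain R B 0 A"
  by (rule ideal_chain.weak[OF ideal_chain.start])

lemma ideal_chain_append:
  assumes "ideal_chain R C n A" "ideal_chain R B m C"
  shows "ideal_chain R B (m + n) A"
  using assms by (induction rule: ideal_chain.induct) (auto intro: ideal_chain.intros)

lemma ideal_chain_le_len:
  assumes "finite_length R B A" "ideal_chain R B n A"
  shows "n \<le> len R B A"
proof -
  obtain N where "\<And>n. ideal_chain R B n A \<Longrightarrow> n \<le> N"
    using assms(1) by (auto simp: finite_length_def)
  with assms(2) show ?thesis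
    unfolding len_def by (rule Greatest_le_nat[of "\<lambda>n. ideal_chain R B n A" n N])
qed

lemma ideal_chain_len:
  assumes "finite_length R B A"
  shows "ideal_chain R B (len R B A) A"
proof -
  obtain N where "\<And>n. ideal_chain R B n A \<Longrightarrow> n \<le> N"
    using assms by (auto simp: finite_length_def)
  then show ?thesis
    unfolding len_def using assms
    by (intro GreatestI_nat[of "\<lambda>n. ideal_chain R B n A" 0 N])
      (auto simp: finite_length_def intro: ideal_chain_zero)
qed

lemma finite_length_subinterval:
  assumes "finite_length R B A" "ideal B' R" "ideal A' R" "B \<subseteq> B'" "B' \<subseteq> A'" "A' \<subseteq> A"
  shows "finite_length R B' A'"
proof -
  have "ideal_chain R B n A" if "ideal_chain R B' n A'" for n
  proof -
    have "ideal_chain R B (0 + n) A'"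
      using assms that by (intro ideal_chain_append[OF that] ideal_chain_zero) (auto simp: finite_length_def)
    then show ?thesis
      using assms by (auto simp: finite_length_def intro: ideal_chain.weak)
  qed
  with assms show ?thesis unfolding finite_length_def by blast
qed

section \<open>Modular law and additivity of length\<close>

context ring
begin

lemma ideal_sum_closed:
  assumes "ideal J R" "a \<in> J" "b \<in> J"
  shows "a \<oplus> b \<in> J" "a \<ominus> b \<in> J" "\<ominus> a \<in> J"
proof -
  interpret ideal J R by fact
  show "a \<oplus> b \<in> J" "a \<ominus> b \<in> J" "\<ominus> a \<in> J"
    using assms(2,3) by (auto simp: a_minus_def)
qed

lemma ideal_zero_mem: "ideal J R \<Longrightarrow> \<zero> \<in> J"
  by (simp add: additive_subgroup.zero_closed ideal.axioms(1))

lemma ideal_subset_carrier: "ideal J R \<Longrightarrow> J \<subseteq> carrier R"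
  by (auto intro: ideal.Icarr)

text \<open>If neither intersection nor sum grows, write x \<in> A' as a + c; then c = x - a lies in
  A' \<inter> C, hence in A, and so does x.\<close>

lemma ideal_modular_strict:
  assumes "ideal A R" "ideal A' R" "ideal C R" "A \<subset> A'"
  shows "A \<inter> C \<subset> A' \<inter> C \<or> set_add R A C \<subset> set_add R A' C"
proof (rule ccontr)
  assume contra: "\<not> ?thesis"
  have "set_add R A C \<subseteq> set_add R A' C" using assms(4) by (auto simp: set_add_def')
  with contra assms(4) have eq: "A' \<inter> C \<subseteq> A" "set_add R A' C \<subseteq> set_add R A C" by auto
  obtain x where x: "x \<in> A'" "x \<notin> A" using assms(4) by blast
  have xc: "x \<in> carrier R" using x assms(2) ideal_subset_carrier by blast
  then have "x \<in> set_add R A' C"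
    using x ideal_zero_mem[OF assms(3)] unfolding set_add_def' by force
  then obtain a c where ac: "a \<in> A" "c \<in> C" "x = a \<oplus> c"
    using eq(2) unfolding set_add_def' by blast
  have "a \<in> carrier R" "c \<in> carrier R"
    using ac assms ideal_subset_carrier by blast+
  then have "c = x \<ominus> a" using ac(3) by (simp add: a_minus_def a_comm r_neg1)
  moreover have "x \<ominus> a \<in> A'" using assms(2,4) x ac by (intro ideal_sum_closed) auto
  ultimately have "c \<in> A" using eq(1) ac(2) by auto
  then show False using x(2) ac ideal_sum_closed(1)[OF assms(1)] by blast
qed

text \<open>Each strict step survives intersection with C or addition of C, by the modular law. For
  C inside the interval this is the upper half of additivity of length, obtained without composition
  series.\<close>

lemma ideal_chain_split:
  assumes "ideal_chain R B n A" "ideal C R"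
  shows "\<exists>i j. ideal_chain R (B \<inter> C) i (A \<inter> C) \<and> ideal_chain R (set_add R B C) j (set_add R A C) \<and> n \<le> i + j"
  using assms
proof (induction rule: ideal_chain.induct)
  case start
  then show ?case
    by (intro exI[of _ 0]) (auto intro!: ideal_chain.start i_intersect add_ideals)
next
  case (strict n A A')
  then obtain i j where ij: "ideal_chain R (B \<inter> C) i (A \<inter> C)"
    "ideal_chain R (set_add R B C) j (set_add R A C)" "n \<le> i + j"
    by blast
  have A: "ideal A R" using strict.hyps(1) ideal_chainD by blast
  have sub: "A \<inter> C \<subseteq> A' \<inter> C" "set_add R A C \<subseteq> set_add R A' C"
    using strict.hyps(2) by (auto simp: set_add_def')
  have id: "ideal (A' \<inter> C) R" "ideal (set_add R A' C) R"
    using strict by (auto intro: i_intersect add_ideals)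
  from ideal_modular_strict[OF A strict.hyps(3) strict.prems strict.hyps(2)] show ?case
  proof
    assume "A \<inter> C \<subset> A' \<inter> C"
    then show ?thesis
      by (intro exI[of _ "Suc i"] exI[of _ j] conjI ideal_chain.strict[OF ij(1) _ id(1)]
          ideal_chain.weak[OF ij(2) sub(2) id(2)]) (use ij(3) in auto)
  next
    assume "set_add R A C \<subset> set_add R A' C"
    then show ?thesis
      by (intro exI[of _ i] exI[of _ "Suc j"] conjI ideal_chain.weak[OF ij(1) sub(1) id(1)]
          ideal_chain.strict[OF ij(2) _ id(2)]) (use ij(3) in auto)
  qed
next
  case (weak n A A')
  then obtain i j where ij: "ideal_chain R (B \<inter> C) i (A \<inter> C)"
    "ideal_chain R (set_add R B C) j (set_add R A C)" "n \<le> i + j"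
    by blast
  have sub: "A \<inter> C \<subseteq> A' \<inter> C" "set_add R A C \<subseteq> set_add R A' C"
    using weak.hyps(2) by (auto simp: set_add_def')
  have id: "ideal (A' \<inter> C) R" "ideal (set_add R A' C) R"
    using weak by (auto intro: i_intersect add_ideals)
  show ?case
    by (intro exI[of _ i] exI[of _ j] conjI ideal_chain.weak[OF ij(1) sub(1) id(1)]
        ideal_chain.weak[OF ij(2) sub(2) id(2)] ij(3))
qed

lemma ideal_add_absorb:
  assumes "ideal A R" "ideal C R" "A \<subseteq> C"
  shows "set_add R A C = C" "set_add R C A = C"
proof -
  have "C \<subseteq> set_add R A C"
  proof
    fix x assume x: "x \<in> C"
    then have "x = \<zero> \<oplus> x" using ideal_subset_carrier[OF assms(2)] by auto
    with x show "x \<in> set_add R A C"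
      using ideal_zero_mem[OF assms(1)] unfolding set_add_def' by blast
  qed
  moreover have "set_add R A C \<subseteq> C"
    using assms ideal_sum_closed(1)[OF assms(2)] unfolding set_add_def' by blast
  ultimately show "set_add R A C = C" by blast
  then show "set_add R C A = C"
    using set_add_comm ideal_subset_carrier assms by metis
qed

lemma ideal_chain_split_interval:
  assumes "ideal_chain R B n A" "ideal C R" "B \<subseteq> C" "C \<subseteq> A"
  shows "\<exists>i j. ideal_chain R B i C \<and> ideal_chain R C j A \<and> n \<le> i + j"
proof -
  have eqs: "B \<inter> C = B" "A \<inter> C = C" "set_add R B C = C" "set_add R A C = A"
    using assms ideal_chainD[OF assms(1)] ideal_add_absorb by auto
  show ?thesis using ideal_chain_split[OF assms(1,2)] unfolding eqs .
qed

lemma finite_length_trans: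
  assumes "finite_length R B C" "finite_length R C A"
  shows "finite_length R B A"
proof -
  have "n \<le> len R B C + len R C A" if n: "ideal_chain R B n A" for n
  proof -
    obtain i j where "ideal_chain R B i C" "ideal_chain R C j A" "n \<le> i + j"
      using ideal_chain_split_interval[OF n, of C] assms unfolding finite_length_def by blast
    with assms ideal_chain_le_len show ?thesis by (meson add_mono order_trans)
  qed
  with assms show ?thesis unfolding finite_length_def by blast
qed

lemma len_add:
  assumes "finite_length R B A" "ideal C R" "B \<subseteq> C" "C \<subseteq> A"
  shows "len R B A = len R B C + len R C A"
proof (rule antisym)
  have id: "ideal B R" "ideal A R" using assms(1) by (auto simp: finite_length_def)
  have fin: "finite_length R B C" "finite_length R C A"
    using assms id by (auto intro: finite_length_subinterval)
  obtain i j where "ideal_chain R B i C" "ideal_chain R C j A" "len R B A \<le> i + j"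
    using ideal_chain_split_interval[OF ideal_chain_len[OF assms(1)] assms(2-4)] by blast
  then show "len R B A \<le> len R B C + len R C A"
    using fin ideal_chain_le_len by (meson add_mono order_trans)
  show "len R B C + len R C A \<le> len R B A"
    by (rule ideal_chain_le_len[OF assms(1) ideal_chain_append[OF
          ideal_chain_len[OF fin(2)] ideal_chain_len[OF fin(1)]]])
qed

lemma len_antimono:
  assumes "finite_length R B A" "ideal C R" "B \<subseteq> C" "C \<subseteq> A"
  shows "len R C A \<le> len R B A"
  using len_add[OF assms] by simp

lemma ideal_chain_trivial: "ideal_chain R B n A \<Longrightarrow> A \<subseteq> B \<Longrightarrow> n = 0"
proof (induction rule: ideal_chain.induct)
  case (strict n A A')
  then show ?case using ideal_chainD(3)[OF strict.hyps(1)] by blast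
next
  case (weak n A A')
  then show ?case by blast
qed simp

lemma finite_length_refl: "ideal A R \<Longrightarrow> finite_length R A A"
  unfolding finite_length_def by (auto dest: ideal_chain_trivial intro!: exI[of _ 0])

lemma len_refl: "ideal A R \<Longrightarrow> len R A A = 0"
  using len_add[OF finite_length_refl, of A A] by auto

end

section \<open>Colon ideals and adjoining elements\<close>

context cring
begin

lemma ideal_criterion:
  assumes "S \<subseteq> carrier R" "\<zero> \<in> S"
    and add: "\<And>x y. x \<in> S \<Longrightarrow> y \<in> S \<Longrightarrow> x \<oplus> y \<in> S"
    and mult: "\<And>r x. r \<in> carrier R \<Longrightarrow> x \<in> S \<Longrightarrow> r \<otimes> x \<in> S"
  shows "ideal S R"
proof (rule idealI)
  show "ring R" by (rule ring_axioms)
  have "\<ominus> x \<in> S" if "x \<in> S" for x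
  proof -
    have "\<ominus> x = \<ominus> \<one> \<otimes> x" using that assms(1) by (simp add: l_minus subset_iff)
    then show ?thesis using mult[of "\<ominus> \<one>" x] that by simp
  qed
  then show "subgroup S (add_monoid R)"
    using assms by (intro add.subgroupI) (auto simp: a_inv_def)
  show "x \<otimes> a \<in> S" "a \<otimes> x \<in> S" if "a \<in> S" "x \<in> carrier R" for a x
    using mult[OF that(2,1)] that assms(1) m_comm[of a x] by (auto simp: subset_iff)
qed

lemma mem_colon: "x \<in> colon R J c \<longleftrightarrow> x \<in> carrier R \<and> c \<otimes> x \<in> J"
  by (simp add: colon_def)

lemma colon_ideal:
  assumes "ideal J R" "c \<in> carrier R"
  shows "ideal (colon R J c) R"
proof (rule ideal_criterion)
  fix x y assume "x \<in> colon R J c" "y \<in> colon R J c"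
  then show "x \<oplus> y \<in> colon R J c"
    using assms ideal_sum_closed(1)[OF assms(1)] by (simp add: mem_colon r_distr)
next
  fix r x assume "r \<in> carrier R" "x \<in> colon R J c"
  then show "r \<otimes> x \<in> colon R J c"
    using assms ideal.I_l_closed[OF assms(1), of "c \<otimes> x" r] by (simp add: mem_colon m_lcomm[of c r x])
qed (use assms ideal_zero_mem in \<open>auto simp: mem_colon\<close>)

lemma adjoin_ideal:
  assumes "ideal J R" "ideal A R" "c \<in> carrier R"
  shows "ideal (adjoin R J c A) R"
proof (rule ideal_criterion)
  note J = subsetD[OF ideal_subset_carrier[OF assms(1)]]
  note A = subsetD[OF ideal_subset_carrier[OF assms(2)]]
  show "adjoin R J c A \<subseteq> carrier R"
    using J A assms(3) by (auto simp: adjoin_def)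
  show "\<zero> \<in> adjoin R J c A"
    unfolding adjoin_def using assms(3) ideal_zero_mem[OF assms(1)] ideal_zero_mem[OF assms(2)]
    by (intro CollectI exI[of _ \<zero>]) simp
  fix x y assume "x \<in> adjoin R J c A" "y \<in> adjoin R J c A"
  then obtain j a j' a' where *: "x = j \<oplus> c \<otimes> a" "y = j' \<oplus> c \<otimes> a'" "j \<in> J" "a \<in> A" "j' \<in> J" "a' \<in> A"
    unfolding adjoin_def by blast
  then have "x \<oplus> y = (j \<oplus> j') \<oplus> c \<otimes> (a \<oplus> a')"
    using J A assms(3) by (simp add: r_distr a_ac)
  then show "x \<oplus> y \<in> adjoin R J c A"
    using * ideal_sum_closed(1)[OF assms(1)] ideal_sum_closed(1)[OF assms(2)]
    unfolding adjoin_def by blast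
next
  note J = subsetD[OF ideal_subset_carrier[OF assms(1)]]
  note A = subsetD[OF ideal_subset_carrier[OF assms(2)]]
  fix r x assume r: "r \<in> carrier R" and "x \<in> adjoin R J c A"
  then obtain j a where *: "x = j \<oplus> c \<otimes> a" "j \<in> J" "a \<in> A"
    unfolding adjoin_def by blast
  then have "r \<otimes> x = r \<otimes> j \<oplus> c \<otimes> (r \<otimes> a)"
    using J A assms(3) r by (simp add: r_distr m_lcomm[of r c a])
  then show "r \<otimes> x \<in> adjoin R J c A"
    using * r ideal.I_l_closed[OF assms(1)] ideal.I_l_closed[OF assms(2)]
    unfolding adjoin_def by blast
qed

lemma adjoin_mono: "A \<subseteq> A' \<Longrightarrow> adjoin R J c A \<subseteq> adjoin R J c A'"
  by (auto simp: adjoin_def)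

lemma Idl_insert:
  assumes "ideal J R" "c \<in> carrier R"
  shows "Idl (insert c J) = adjoin R J c (carrier R)"
proof (rule antisym)
  note J = subsetD[OF ideal_subset_carrier[OF assms(1)]]
  have ic: "insert c J \<subseteq> carrier R" using assms J by auto
  have "c \<in> adjoin R J c (carrier R)"
    unfolding adjoin_def using assms ideal_zero_mem[OF assms(1)]
    by (intro CollectI exI[of _ \<zero>] exI[of _ \<one>]) simp
  moreover have "J \<subseteq> adjoin R J c (carrier R)"
  proof
    fix j assume "j \<in> J"
    moreover from this have "j = j \<oplus> c \<otimes> \<zero>" using assms J by simp
    ultimately show "j \<in> adjoin R J c (carrier R)" unfolding adjoin_def by blast
  qed
  ultimately show "Idl (insert c J) \<subseteq> adjoin R J c (carrier R)"
    using adjoin_ideal[OF assms(1) oneideal assms(2)] by (intro genideal_minimal) auto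
  show "adjoin R J c (carrier R) \<subseteq> Idl (insert c J)"
  proof
    fix x assume "x \<in> adjoin R J c (carrier R)"
    then obtain j a where *: "x = j \<oplus> c \<otimes> a" "j \<in> J" "a \<in> carrier R"
      unfolding adjoin_def by blast
    have "j \<in> Idl (insert c J)" "c \<in> Idl (insert c J)"
      using genideal_self[OF ic] * by auto
    then show "x \<in> Idl (insert c J)"
      using * ideal_sum_closed(1)[OF genideal_ideal[OF ic]]
        ideal.I_r_closed[OF genideal_ideal[OF ic]] by blast
  qed
qed

text \<open>For x in A' but not in A, the element cx is new: cx = j + ca would put x - a into J : c,
  which lies in A.\<close>

lemma ideal_chain_adjoin:
  assumes "ideal_chain R (colon R J c) n A" "ideal J R" "c \<in> carrier R"
  shows "ideal_chain R J n (adjoin R J c A)"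
  using assms
proof (induction rule: ideal_chain.induct)
  case start
  have "adjoin R J c (colon R J c) = J"
  proof (rule antisym)
    show "adjoin R J c (colon R J c) \<subseteq> J"
      using ideal_sum_closed(1)[OF assms(2)] by (auto simp: adjoin_def mem_colon)
    show "J \<subseteq> adjoin R J c (colon R J c)"
    proof
      fix j assume "j \<in> J"
      moreover from this have "j = j \<oplus> c \<otimes> \<zero>"
        using assms(2,3) subsetD[OF ideal_subset_carrier[OF assms(2)]] by simp
      moreover have "\<zero> \<in> colon R J c"
        using assms(2,3) by (simp add: mem_colon ideal_zero_mem)
      ultimately show "j \<in> adjoin R J c (colon R J c)" unfolding adjoin_def by blast
    qed
  qed
  then show ?case using ideal_chain.start[OF assms(2)] by simp
next
  case (strict n A A')
  have AD: "ideal A R" "colon R J c \<subseteq> A" using ideal_chainD[OF strict.hyps(1)] by auto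
  obtain x where x: "x \<in> A'" "x \<notin> A" using strict.hyps by blast
  have xc: "x \<in> carrier R" using x strict.hyps(3) ideal_subset_carrier by blast
  have "c \<otimes> x \<in> adjoin R J c A'"
    unfolding adjoin_def using x xc assms(2,3) ideal_zero_mem[OF assms(2)]
    by (intro CollectI exI[of _ \<zero>] exI[of _ x]) simp
  moreover have "c \<otimes> x \<notin> adjoin R J c A"
  proof
    assume "c \<otimes> x \<in> adjoin R J c A"
    then obtain j a where *: "c \<otimes> x = j \<oplus> c \<otimes> a" "j \<in> J" "a \<in> A"
      unfolding adjoin_def by blast
    have ac: "a \<in> carrier R" "j \<in> carrier R" using * AD assms(2) ideal_subset_carrier by blast+
    have "c \<otimes> (x \<ominus> a) = c \<otimes> x \<ominus> c \<otimes> a"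
      using assms(3) xc ac by (simp add: a_minus_def r_distr r_minus)
    also have "\<dots> = j"
      using assms(3) ac by (simp add: *(1) a_minus_def a_assoc r_neg)
    finally have "x \<ominus> a \<in> colon R J c" using * xc ac by (simp add: mem_colon)
    then have "(x \<ominus> a) \<oplus> a \<in> A" using AD *(3) ideal_sum_closed(1) by blast
    moreover have "(x \<ominus> a) \<oplus> a = x" using xc ac by (simp add: a_minus_def a_assoc l_neg)
    ultimately show False using x by simp
  qed
  ultimately have "adjoin R J c A \<subset> adjoin R J c A'"
    using adjoin_mono[of A A'] strict.hyps(2) by blast
  then show ?case
    by (rule ideal_chain.strict[OF strict.IH[OF strict.prems] _
          adjoin_ideal[OF assms(2) strict.hyps(3) assms(3)]])
next
  case (weak n A A')
  then show ?case
    using ideal_chain.weak[OF weak.IH[OF weak.prems] adjoin_mono adjoin_ideal] by blast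
qed

text \<open>Containment in J + cR lets a new element be written j + ca; then a is new in the colon
  ideal, as j already lies in the smaller ideal.\<close>

lemma ideal_chain_colon:
  assumes "ideal_chain R J n A" "c \<in> carrier R" "A \<subseteq> adjoin R J c (carrier R)"
  shows "ideal_chain R (colon R J c) n (colon R A c)"
  using assms
proof (induction rule: ideal_chain.induct)
  case start
  then show ?case by (intro ideal_chain.start colon_ideal)
next
  case (strict n A A')
  have AD: "ideal A R" "J \<subseteq> A" "ideal J R" using ideal_chainD[OF strict.hyps(1)] by auto
  obtain x where x: "x \<in> A'" "x \<notin> A" using strict.hyps by blast
  then obtain j a where *: "x = j \<oplus> c \<otimes> a" "j \<in> J" "a \<in> carrier R"
    using strict.prems unfolding adjoin_def by blast
  have jc: "j \<in> carrier R" using * AD(3) ideal_subset_carrier by blast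
  have "c \<otimes> a = x \<ominus> j" using * jc strict.prems(1) by (simp add: a_minus_def a_comm r_neg1)
  also have "\<dots> \<in> A'" using strict.hyps x * AD by (intro ideal_sum_closed) auto
  finally have "a \<in> colon R A' c" using * by (simp add: mem_colon)
  moreover have "a \<notin> colon R A c"
    using x * AD ideal_sum_closed(1)[OF AD(1)] by (auto simp: mem_colon)
  moreover have "colon R A c \<subseteq> colon R A' c" using strict.hyps(2) by (auto simp: mem_colon)
  ultimately have "colon R A c \<subset> colon R A' c" by blast
  moreover have "ideal_chain R (colon R J c) n (colon R A c)"
    using strict by blast
  ultimately show ?case
    using ideal_chain.strict[OF _ _ colon_ideal[OF strict.hyps(3) strict.prems(1)]] by blast
next
  case (weak n A A')
  then have "ideal_chain R (colon R J c) n (colon R A c)" by blast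
  moreover have "colon R A c \<subseteq> colon R A' c" using weak.hyps(2) by (auto simp: mem_colon)
  ultimately show ?case
    using ideal_chain.weak[OF _ _ colon_ideal[OF weak.hyps(3) weak.prems(1)]] by blast
qed

lemma colon_adjoin_carrier:
  assumes "ideal J R" "c \<in> carrier R"
  shows "colon R (adjoin R J c (carrier R)) c = carrier R"
proof (intro antisym subsetI)
  fix x assume x: "x \<in> carrier R"
  then have "c \<otimes> x = \<zero> \<oplus> c \<otimes> x" using assms by simp
  then show "x \<in> colon R (adjoin R J c (carrier R)) c"
    using x ideal_zero_mem[OF assms(1)] unfolding mem_colon adjoin_def by blast
qed (simp add: mem_colon)

text \<open>Chains transfer in both directions under \<open>adjoin\<close> and \<open>colon\<close>,
  so both intervals admit the same chain lengths n.\<close>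

lemma len_insert:
  assumes "ideal J R" "c \<in> carrier R" "finite_length R (colon R J c) (carrier R)"
  shows "finite_length R J (Idl (insert c J))"
    and "len R J (Idl (insert c J)) = len R (colon R J c) (carrier R)"
proof -
  have iff: "ideal_chain R J n (Idl (insert c J)) \<longleftrightarrow> ideal_chain R (colon R J c) n (carrier R)" for n
    unfolding Idl_insert[OF assms(1,2)]
    using ideal_chain_adjoin[OF _ assms(1,2)] ideal_chain_colon[OF _ assms(2) order_refl, of J n]
    by (auto simp: colon_adjoin_carrier[OF assms(1,2)])
  have "J \<subseteq> carrier R" using assms(1) by (rule ideal_subset_carrier)
  then have "insert c J \<subseteq> carrier R" using assms(2) by simp
  then have "ideal (Idl (insert c J)) R" "J \<subseteq> Idl (insert c J)"
    using genideal_ideal genideal_self[of "insert c J"] by auto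
  then show "finite_length R J (Idl (insert c J))"
    using assms unfolding finite_length_def iff by auto
  show "len R J (Idl (insert c J)) = len R (colon R J c) (carrier R)"
    unfolding len_def iff ..
qed

lemma Idl_insert_Idl:
  assumes "S \<subseteq> carrier R" "c \<in> carrier R"
  shows "Idl (insert c (Idl S)) = Idl (insert c S)"
proof -
  have id: "ideal (Idl S) R" "Idl S \<subseteq> carrier R"
    using assms genideal_ideal ideal_subset_carrier by auto
  show ?thesis
  proof (rule antisym)
    show "Idl (insert c (Idl S)) \<subseteq> Idl (insert c S)"
      using assms genideal_self[of "insert c S"] subset_Idl_subset[of "insert c S" S]
      by (intro genideal_minimal genideal_ideal) auto
    show "Idl (insert c S) \<subseteq> Idl (insert c (Idl S))"
      using assms id genideal_self[of S] by (intro subset_Idl_subset) auto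
  qed
qed

lemma Idl_ideal: "ideal J R \<Longrightarrow> Idl J = J"
  by (meson antisym genideal_minimal genideal_self ideal_subset_carrier order_refl)

text \<open>Adjoined one at a time, each element contributes the length of R modulo a colon ideal
  that contains K.\<close>

lemma len_adjoin_finite:
  assumes "ideal J R" "finite S" "S \<subseteq> carrier R" "finite_length R K (carrier R)"
    and "\<And>s. s \<in> S \<Longrightarrow> K \<subseteq> colon R J s"
  shows "finite_length R J (Idl (J \<union> S)) \<and> len R J (Idl (J \<union> S)) \<le> card S * len R K (carrier R)"
  using assms(2,3,5)
proof (induction S rule: finite_induct)
  case empty
  have "finite_length R J J" using assms(1) by (rule finite_length_refl)
  moreover have "len R J J = 0" using assms(1) by (rule len_refl)
  ultimately show ?case using assms(1) by (simp add: Idl_ideal)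
next
  case (insert s S)
  define J' where "J' = Idl (J \<union> S)"
  have sub: "J \<union> S \<subseteq> carrier R" "s \<in> carrier R"
    using insert.prems assms(1) ideal_subset_carrier by auto
  have J': "ideal J' R" "J \<subseteq> J'"
    using genideal_ideal[OF sub(1)] genideal_self[OF sub(1)] by (auto simp: J'_def)
  have eq: "Idl (J \<union> insert s S) = Idl (insert s J')"
    using Idl_insert_Idl[OF sub] by (simp add: J'_def)
  have IH: "finite_length R J J'" "len R J J' \<le> card S * len R K (carrier R)"
    using insert by (auto simp: J'_def)
  have K: "K \<subseteq> colon R J' s" using insert.prems J' by (fastforce simp: mem_colon)
  have fin: "finite_length R (colon R J' s) (carrier R)"
    using assms(4) K J' sub
    by (intro finite_length_subinterval[OF assms(4)] colon_ideal oneideal ideal_subset_carrier)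
  note li = len_insert[OF J'(1) sub(2) fin]
  have tot: "finite_length R J (Idl (insert s J'))"
    using IH(1) li(1) by (rule finite_length_trans)
  have "len R J (Idl (insert s J')) = len R J J' + len R J' (Idl (insert s J'))"
    using J' li(1) by (intro len_add tot) (auto simp: finite_length_def)
  also have "\<dots> \<le> card S * len R K (carrier R) + len R K (carrier R)"
    using IH(2) K J' sub
    by (intro add_mono) (auto simp: li(2) intro!: len_antimono assms(4) colon_ideal ideal_subset_carrier)
  finally show ?case unfolding eq using tot insert.hyps by simp
qed

text \<open>The exact count: adjoined in increasing order, \<open>f i\<close> contributes the length
  of R modulo its colon by the earlier ones. For monomials these colons are the ideals
  \<open>lead\<close>.\<close>

lemma len_adjoin_sorted:
  fixes f :: "'i::linorder \<Rightarrow> 'a"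
  assumes "finite_length R J (carrier R)" "finite S" "f ` S \<subseteq> carrier R"
  shows "len R J (Idl (J \<union> f ` S)) =
    (\<Sum>i\<in>S. len R (colon R (Idl (J \<union> f ` {k \<in> S. k < i})) (f i)) (carrier R))"
  using assms(2,3)
proof (induction S rule: finite_linorder_max_induct)
  case empty
  have J: "ideal J R" using assms(1) by (simp add: finite_length_def)
  have "len R J J = 0" using J by (rule len_refl)
  then show ?case using J by (simp add: Idl_ideal)
next
  case (insert b A)
  define J' where "J' = Idl (J \<union> f ` A)"
  have J: "ideal J R" "J \<subseteq> carrier R" using assms(1) by (auto simp: finite_length_def)
  have sub: "J \<union> f ` A \<subseteq> carrier R" "f b \<in> carrier R"
    using insert.prems J by auto
  have J': "ideal J' R" "J \<subseteq> J'"
    using genideal_ideal[OF sub(1)] genideal_self[OF sub(1)] by (auto simp: J'_def)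
  have eq: "Idl (J \<union> f ` insert b A) = Idl (insert (f b) J')"
    using Idl_insert_Idl[OF sub] by (simp add: J'_def)
  have insc: "insert (f b) J' \<subseteq> carrier R" using J' sub ideal_subset_carrier by auto
  have top: "ideal (Idl (insert (f b) J')) R" "J' \<subseteq> Idl (insert (f b) J')"
    "Idl (insert (f b) J') \<subseteq> carrier R"
    using genideal_ideal[OF insc] genideal_self[OF insc] ideal_subset_carrier by auto
  have "J \<subseteq> colon R J' (f b)"
    using subsetD[OF J(2)] subsetD[OF J'(2)] sub(2) ideal.I_l_closed[OF J'(1)]
    by (auto simp: mem_colon)
  then have fin: "finite_length R (colon R J' (f b)) (carrier R)"
    using J J' sub
    by (intro finite_length_subinterval[OF assms(1)] colon_ideal oneideal ideal_subset_carrier)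
  have "len R J (Idl (insert (f b) J')) = len R J J' + len R J' (Idl (insert (f b) J'))"
    using J J' top by (intro len_add finite_length_subinterval[OF assms(1)]) auto
  also have "len R J' (Idl (insert (f b) J')) = len R (colon R J' (f b)) (carrier R)"
    by (rule len_insert(2)[OF J'(1) sub(2) fin])
  also have "len R J J' = (\<Sum>i\<in>A. len R (colon R (Idl (J \<union> f ` {k \<in> A. k < i})) (f i)) (carrier R))"
    using insert by (simp add: J'_def)
  also have "\<dots> = (\<Sum>i\<in>A. len R (colon R (Idl (J \<union> f ` {k \<in> insert b A. k < i})) (f i)) (carrier R))"
  proof (rule sum.cong[OF refl])
    fix i assume "i \<in> A"
    then have "{k \<in> A. k < i} = {k \<in> insert b A. k < i}" using insert.hyps(2) by auto
    then show "len R (colon R (Idl (J \<union> f ` {k \<in> A. k < i})) (f i)) (carrier R) =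
      len R (colon R (Idl (J \<union> f ` {k \<in> insert b A. k < i})) (f i)) (carrier R)" by simp
  qed
  finally have sum: "len R J (Idl (insert (f b) J')) = \<dots> + len R (colon R J' (f b)) (carrier R)" .
  have "{k \<in> insert b A. k < b} = A" using insert.hyps(2) by auto
  then have J'_eq: "Idl (J \<union> f ` {k \<in> insert b A. k < b}) = J'" by (simp add: J'_def)
  have "b \<notin> A" using insert.hyps(2) by auto
  then show ?case
    unfolding eq sum sum.insert[OF insert.hyps(1) \<open>b \<notin> A\<close>] J'_eq by simp
qed

end

section \<open>Monomials and the adic filtration\<close>

primrec monomial :: "('a, 'b) ring_scheme \<Rightarrow> 'a list \<Rightarrow> nat list \<Rightarrow> 'a" where
  "monomial R [] \<alpha> = \<one>\<^bsub>R\<^esub>"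
| "monomial R (a # as) \<alpha> = a [^]\<^bsub>R\<^esub> hd \<alpha> \<otimes>\<^bsub>R\<^esub> monomial R as (tl \<alpha>)"

text \<open>For I generated by \<open>as\<close> this is P + I^n. Monomial generators of exact
  degree n reduce inclusions to exponent vectors; P = {0} gives I^n, a prime P the filtration of
  R/P.\<close>

definition filt :: "('a, 'b) ring_scheme \<Rightarrow> 'a set \<Rightarrow> 'a list \<Rightarrow> nat \<Rightarrow> 'a set" where
  "filt R P as n = Idl\<^bsub>R\<^esub> (P \<union> monomial R as ` exps (length as) n)"

text \<open>For a graded family of ideals \<open>B\<close>, the ideal of leading coefficients at the monomial \<open>\<alpha>\<close>: all
  \<open>r\<close> such that \<open>r a\<^sup>\<alpha>\<close> lies in \<open>B |\<alpha>|\<close> up to smaller monomials of the same degree.\<close>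

definition lead :: "('a, 'b) ring_scheme \<Rightarrow> (nat \<Rightarrow> 'a set) \<Rightarrow> 'a list \<Rightarrow> nat list \<Rightarrow> 'a set" where
  "lead R B as \<alpha> = colon R (Idl\<^bsub>R\<^esub> (B (sum_list \<alpha>) \<union>
     monomial R as ` {\<beta> \<in> exps (length as) (sum_list \<alpha>). \<beta> < \<alpha>})) (monomial R as \<alpha>)"

context cring
begin

lemma monomial_closed [simp]: "set as \<subseteq> carrier R \<Longrightarrow> monomial R as \<alpha> \<in> carrier R"
  by (induction as arbitrary: \<alpha>) auto

lemma monomial_image_closed: "set as \<subseteq> carrier R \<Longrightarrow> monomial R as ` S \<subseteq> carrier R"
  by auto

lemma monomial_add:
  assumes "set as \<subseteq> carrier R" "length \<alpha> = length as" "length \<gamma> = length as"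
  shows "monomial R as (exp_add \<alpha> \<gamma>) = monomial R as \<alpha> \<otimes> monomial R as \<gamma>"
  using assms
proof (induction as arbitrary: \<alpha> \<gamma>)
  case (Cons a as)
  obtain x xs y ys where eq: "\<alpha> = x # xs" "\<gamma> = y # ys"
    using Cons.prems by (metis length_Suc_conv list.size(4))
  have "monomial R as xs \<in> carrier R" "monomial R as ys \<in> carrier R" "a \<in> carrier R"
    using Cons.prems by auto
  moreover have "monomial R as (exp_add xs ys) = monomial R as xs \<otimes> monomial R as ys"
    using Cons eq by auto
  ultimately show ?case by (simp add: eq nat_pow_mult[symmetric] m_ac)
qed simp

lemma monomial_scale:
  assumes "set as \<subseteq> carrier R" "length \<gamma> = length as"
  shows "monomial R as (map (\<lambda>i. i * u) \<gamma>) = monomial R as \<gamma> [^] u"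
  using assms
proof (induction as arbitrary: \<gamma>)
  case (Cons a as)
  obtain x xs where eq: "\<gamma> = x # xs"
    using Cons.prems by (metis length_Suc_conv list.size(4))
  then show ?case using Cons by (simp add: nat_pow_pow nat_pow_distrib)
qed (simp add: nat_pow_one)

lemma monomial_zero: "set as \<subseteq> carrier R \<Longrightarrow> monomial R as (replicate (length as) 0) = \<one>"
  by (induction as) auto

lemma monomial_unit:
  assumes "set as \<subseteq> carrier R" "a \<in> set as"
  shows "\<exists>\<epsilon> \<in> exps (length as) 1. monomial R as \<epsilon> = a"
  using assms
proof (induction as)
  case (Cons b as)
  show ?case
  proof (cases "a = b")
    case True
    with Cons.prems show ?thesis
      by (intro bexI[of _ "1 # replicate (length as) 0"]) (auto simp: monomial_zero exps_def sum_list_replicate)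
  next
    case False
    with Cons obtain \<epsilon> where "\<epsilon> \<in> exps (length as) 1" "monomial R as \<epsilon> = a" by auto
    with Cons.prems show ?thesis by (intro bexI[of _ "0 # \<epsilon>"]) (auto simp: exps_def)
  qed
qed simp

text \<open>Pigeonhole: exponents all below e could not add up to more than
  \<open>length as * e\<close>.\<close>

lemma monomial_mem_ideal_of_powers:
  assumes "ideal J R" "set as \<subseteq> carrier R" "\<And>a. a \<in> set as \<Longrightarrow> a [^] e \<in> J"
    and "length \<alpha> = length as" "length as * e < sum_list \<alpha>"
  shows "monomial R as \<alpha> \<in> J"
  using assms(2-5)
proof (induction as arbitrary: \<alpha>)
  case (Cons a as)
  obtain x xs where eq: "\<alpha> = x # xs"
    using Cons.prems by (metis length_Suc_conv list.size(4))
  have closed: "a \<in> carrier R" "monomial R as xs \<in> carrier R" using Cons.prems by auto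
  show ?case
  proof (cases "e \<le> x")
    case True
    then have "a [^] x = a [^] (x - e) \<otimes> a [^] e" using closed by (simp add: nat_pow_mult)
    then have "a [^] x \<in> J" using Cons.prems closed ideal.I_l_closed[OF assms(1)] by auto
    then show ?thesis using closed ideal.I_r_closed[OF assms(1)] by (simp add: eq)
  next
    case False
    then have "monomial R as xs \<in> J" using Cons eq by auto
    then show ?thesis using closed ideal.I_l_closed[OF assms(1)] by (simp add: eq)
  qed
qed simp

text \<open>Keeping \<zero> among the generators gives the second summand the shape of
  \<open>filt R {\<zero>} as n\<close>, to which Artin-Rees applies.\<close>

lemma Idl_Un_decomp:
  assumes "ideal B R" "S \<subseteq> carrier R" "x \<in> Idl (B \<union> S)"
  obtains b s where "b \<in> B" "s \<in> Idl ({\<zero>} \<union> S)" "x = b \<oplus> s"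
proof -
  have S: "{\<zero>} \<union> S \<subseteq> carrier R" using assms(2) by simp
  have id: "ideal (Idl ({\<zero>} \<union> S)) R" by (rule genideal_ideal[OF S])
  have "B \<union> S \<subseteq> set_add R B (Idl ({\<zero>} \<union> S))"
  proof
    fix x assume "x \<in> B \<union> S"
    moreover from this have "x = \<zero> \<oplus> x" "x = x \<oplus> \<zero>"
      using assms(1,2) ideal_subset_carrier by (auto simp: subset_iff)
    ultimately show "x \<in> set_add R B (Idl ({\<zero>} \<union> S))"
      using ideal_zero_mem[OF assms(1)] ideal_zero_mem[OF id] genideal_self[OF S]
      unfolding set_add_def' by blast
  qed
  then have "Idl (B \<union> S) \<subseteq> set_add R B (Idl ({\<zero>} \<union> S))"
    using assms(1) id by (intro genideal_minimal add_ideals)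
  with assms(3) that show thesis unfolding set_add_def' by blast
qed

text \<open>Multiplying a relation at \<beta> by the monomial of \<gamma> keeps smaller monomials
  smaller and respects the family by \<open>B_mult\<close>. That condition holds both for the
  shifted filtration and for a constant ideal.\<close>

lemma lead_mono:
  assumes as: "set as \<subseteq> carrier R"
    and B: "\<And>n. ideal (B n) R"
    and B_mult: "\<And>n \<gamma> x. length \<gamma> = length as \<Longrightarrow> x \<in> B n \<Longrightarrow>
      monomial R as \<gamma> \<otimes> x \<in> B (n + sum_list \<gamma>)"
    and len: "length \<beta> = length as" "length \<gamma> = length as"
  shows "lead R B as \<beta> \<subseteq> lead R B as (exp_add \<beta> \<gamma>)"
proof
  define W where "W \<delta> = B (sum_list \<delta>) \<union> monomial R as ` {\<beta> \<in> exps (length as) (sum_list \<delta>). \<beta> < \<delta>}" for \<delta>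
  have W_sub: "W \<delta> \<subseteq> carrier R" for \<delta>
    using ideal_subset_carrier[OF B] as by (auto simp: W_def)
  have "W \<beta> \<subseteq> colon R (Idl (W (exp_add \<beta> \<gamma>))) (monomial R as \<gamma>)"
  proof
    fix x assume x: "x \<in> W \<beta>"
    then have xc: "x \<in> carrier R" using W_sub by blast
    have "monomial R as \<gamma> \<otimes> x \<in> W (exp_add \<beta> \<gamma>)"
    proof (cases "x \<in> B (sum_list \<beta>)")
      case True
      then show ?thesis using B_mult[OF len(2) True] len by (simp add: W_def sum_list_exp_add)
    next
      case False
      then obtain \<delta> where \<delta>: "\<delta> \<in> exps (length as) (sum_list \<beta>)" "\<delta> < \<beta>" "x = monomial R as \<delta>"
        using x by (auto simp: W_def)
      then have "monomial R as \<gamma> \<otimes> x = monomial R as (exp_add \<delta> \<gamma>)"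
        using as len by (simp add: exps_def monomial_add m_comm)
      moreover have "exp_add \<delta> \<gamma> < exp_add \<beta> \<gamma>"
        using \<delta> len by (intro exp_add_less_mono) (auto simp: exps_def)
      moreover have "exp_add \<delta> \<gamma> \<in> exps (length as) (sum_list (exp_add \<beta> \<gamma>))"
        using \<delta> len by (auto simp: exps_def sum_list_exp_add)
      ultimately show ?thesis by (auto simp: W_def)
    qed
    then show "x \<in> colon R (Idl (W (exp_add \<beta> \<gamma>))) (monomial R as \<gamma>)"
      using xc genideal_self[OF W_sub] by (auto simp: mem_colon)
  qed
  then have *: "Idl (W \<beta>) \<subseteq> colon R (Idl (W (exp_add \<beta> \<gamma>))) (monomial R as \<gamma>)"
    using as W_sub by (intro genideal_minimal colon_ideal genideal_ideal) auto
  fix x assume "x \<in> lead R B as \<beta>"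
  then have x: "x \<in> carrier R" "monomial R as \<beta> \<otimes> x \<in> Idl (W \<beta>)"
    by (auto simp: lead_def mem_colon W_def)
  have "monomial R as (exp_add \<beta> \<gamma>) \<otimes> x = monomial R as \<gamma> \<otimes> (monomial R as \<beta> \<otimes> x)"
    using as len x by (simp add: monomial_add m_ac)
  then show "x \<in> lead R B as (exp_add \<beta> \<gamma>)"
    using * x by (auto simp: lead_def mem_colon W_def)
qed

lemma lead_ideal:
  assumes "set as \<subseteq> carrier R" "ideal (B (sum_list \<alpha>)) R"
  shows "ideal (lead R B as \<alpha>) R"
  unfolding lead_def
proof (intro colon_ideal genideal_ideal Un_least monomial_image_closed monomial_closed)
  show "B (sum_list \<alpha>) \<subseteq> carrier R" using assms(2) by (rule ideal_subset_carrier)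
qed (use assms in auto)

section \<open>The filtration P + I^n and its Hilbert function\<close>

context
  fixes P :: "'a set" and as :: "'a list"
  assumes P: "ideal P R" and as: "set as \<subseteq> carrier R"
begin

lemma filt_gens_closed: "P \<union> monomial R as ` exps (length as) n \<subseteq> carrier R"
  using ideal_subset_carrier[OF P] as by auto

lemma filt_ideal: "ideal (filt R P as n) R"
  unfolding filt_def by (rule genideal_ideal[OF filt_gens_closed])

lemma filt_gens: "P \<subseteq> filt R P as n" "monomial R as ` exps (length as) n \<subseteq> filt R P as n"
  using genideal_self[OF filt_gens_closed] by (auto simp: filt_def)

lemma filt_minimal:
  "ideal J R \<Longrightarrow> P \<subseteq> J \<Longrightarrow> (\<And>\<alpha>. \<alpha> \<in> exps (length as) n \<Longrightarrow> monomial R as \<alpha> \<in> J) \<Longrightarrow> filt R P as n \<subseteq> J"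
  unfolding filt_def by (rule genideal_minimal) auto

lemma filt_0: "filt R P as 0 = carrier R"
proof -
  have "replicate (length as) 0 \<in> exps (length as) 0" by (simp add: exps_def sum_list_replicate)
  then have "monomial R as (replicate (length as) 0) \<in> filt R P as 0" using filt_gens(2) by blast
  then have "\<one> \<in> filt R P as 0" using monomial_zero[OF as] by simp
  then show ?thesis using ideal.one_imp_carrier[OF filt_ideal] by blast
qed

lemma filt_mult_monomial:
  assumes "x \<in> filt R P as n" "length \<gamma> = length as"
  shows "monomial R as \<gamma> \<otimes> x \<in> filt R P as (n + sum_list \<gamma>)"
proof -
  have "filt R P as n \<subseteq> colon R (filt R P as (n + sum_list \<gamma>)) (monomial R as \<gamma>)"
  proof (rule filt_minimal)
    show "P \<subseteq> colon R (filt R P as (n + sum_list \<gamma>)) (monomial R as \<gamma>)"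
    proof
      fix x assume "x \<in> P"
      then show "x \<in> colon R (filt R P as (n + sum_list \<gamma>)) (monomial R as \<gamma>)"
        using ideal.I_l_closed[OF filt_ideal] subsetD[OF filt_gens(1)] as ideal.Icarr[OF P]
        by (auto simp: mem_colon)
    qed
    fix \<alpha> assume \<alpha>: "\<alpha> \<in> exps (length as) n"
    then have "exp_add \<alpha> \<gamma> \<in> exps (length as) (n + sum_list \<gamma>)"
      using assms(2) by (auto simp: exps_def sum_list_exp_add)
    then have "monomial R as (exp_add \<alpha> \<gamma>) \<in> filt R P as (n + sum_list \<gamma>)" using filt_gens(2) by blast
    then show "monomial R as \<alpha> \<in> colon R (filt R P as (n + sum_list \<gamma>)) (monomial R as \<gamma>)"
      using \<alpha> assms(2) as by (simp add: mem_colon exps_def monomial_add m_comm)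
  qed (use as filt_ideal colon_ideal in auto)
  with assms(1) show ?thesis by (auto simp: mem_colon)
qed

lemma filt_mult:
  assumes "x \<in> filt R P as m" "y \<in> filt R P as n"
  shows "x \<otimes> y \<in> filt R P as (m + n)"
proof -
  have y: "y \<in> carrier R" using ideal.Icarr[OF filt_ideal assms(2)] .
  have "filt R P as m \<subseteq> colon R (filt R P as (m + n)) y"
  proof (rule filt_minimal)
    show "P \<subseteq> colon R (filt R P as (m + n)) y"
    proof
      fix x assume "x \<in> P"
      then show "x \<in> colon R (filt R P as (m + n)) y"
        using ideal.I_l_closed[OF filt_ideal] subsetD[OF filt_gens(1)] y ideal.Icarr[OF P]
        by (auto simp: mem_colon)
    qed
    fix \<alpha> assume "\<alpha> \<in> exps (length as) m"
    then show "monomial R as \<alpha> \<in> colon R (filt R P as (m + n)) y"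
      using filt_mult_monomial[OF assms(2), of \<alpha>] as y
      by (simp add: mem_colon exps_def m_comm add.commute)
  qed (use y filt_ideal colon_ideal in auto)
  with assms(1) have "y \<otimes> x \<in> filt R P as (m + n)" by (auto simp: mem_colon)
  then show ?thesis using y ideal.Icarr[OF filt_ideal assms(1)] by (simp add: m_comm)
qed

lemma filt_antimono:
  assumes "m \<le> n"
  shows "filt R P as n \<subseteq> filt R P as m"
proof (rule filt_minimal[OF filt_ideal filt_gens(1)])
  fix \<alpha> assume \<alpha>: "\<alpha> \<in> exps (length as) n"
  then obtain \<beta> where \<beta>: "exp_le \<beta> \<alpha>" "sum_list \<beta> = m"
    using exp_truncate[of m \<alpha>] assms by (auto simp: exps_def)
  then obtain \<gamma> where \<gamma>: "length \<gamma> = length \<alpha>" "\<alpha> = exp_add \<beta> \<gamma>"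
    using exp_le_imp_exp_add by blast
  have len: "length \<beta> = length as" using \<beta> \<alpha> by (auto simp: exps_def dest: list_all2_lengthD)
  with \<beta> have "monomial R as \<beta> \<in> filt R P as m" using filt_gens(2) by (auto simp: exps_def)
  then have "monomial R as \<beta> \<otimes> monomial R as \<gamma> \<in> filt R P as m"
    using as ideal.I_r_closed[OF filt_ideal] by auto
  then show "monomial R as \<alpha> \<in> filt R P as m"
    using \<gamma> len \<alpha> as monomial_add by (auto simp: exps_def)
qed

lemma Idl_filt_gens: "m \<ge> n \<Longrightarrow> Idl (filt R P as m \<union> monomial R as ` exps (length as) n) = filt R P as n"
proof (rule antisym)
  assume "m \<ge> n"
  then show "Idl (filt R P as m \<union> monomial R as ` exps (length as) n) \<subseteq> filt R P as n"
    using filt_antimono filt_gens filt_ideal by (intro genideal_minimal) auto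
  have sub: "filt R P as m \<union> monomial R as ` exps (length as) n \<subseteq> carrier R"
    using ideal_subset_carrier[OF filt_ideal] as by auto
  show "filt R P as n \<subseteq> Idl (filt R P as m \<union> monomial R as ` exps (length as) n)"
    using genideal_self[OF sub] filt_gens(1)[of m] by (intro filt_minimal genideal_ideal sub) auto
qed

text \<open>Each graded piece is generated by finitely many monomials annihilated by the first step
  of the filtration, so its length is finite.\<close>

lemma finite_length_filt:
  assumes "finite_length R (filt R P as 1) (carrier R)"
  shows "finite_length R (filt R P as n) (carrier R)"
proof (induction n)
  case 0
  then show ?case by (simp add: filt_0 finite_length_refl oneideal)
next
  case (Suc n)
  have "filt R P as 1 \<subseteq> colon R (filt R P as (Suc n)) (monomial R as \<alpha>)"
    if "\<alpha> \<in> exps (length as) n" for \<alpha>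
    using that filt_mult_monomial[of _ 1 \<alpha>] ideal.Icarr[OF filt_ideal]
    by (auto simp: mem_colon exps_def)
  then have "finite_length R (filt R P as (Suc n)) (filt R P as n)"
    using len_adjoin_finite[OF filt_ideal _ monomial_image_closed[OF as] assms,
        of "exps (length as) n" "Suc n"]
    by (auto simp: finite_exps Idl_filt_gens)
  then show ?case using Suc finite_length_trans by blast
qed

text \<open>The length of the degree n piece is the sum, over exponents \<alpha> of degree n, of the
  lengths of R modulo \<open>lead\<close> at \<alpha>. These can only drop as \<alpha> grows, so the
  claim becomes one about sums over exponent vectors.\<close>

lemma hilbert_function_eventually_mono:
  assumes "finite_length R (filt R P as 1) (carrier R)"
  shows "\<exists>n0. \<forall>n\<ge>n0. len R (filt R P as (Suc n)) (filt R P as n) \<le>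
    len R (filt R P as (Suc (Suc n))) (filt R P as (Suc n))"
proof -
  \<comment> \<open>The shift makes \<open>B n\<close> the denominator of the degree n piece, so
    \<open>lead\<close> takes leading coefficients in the associated graded ring.\<close>
  define B where "B n = filt R P as (Suc n)" for n
  define g where "g \<alpha> = len R (lead R B as \<alpha>) (carrier R)" for \<alpha>
  have B: "ideal (B n) R" for n by (simp add: B_def filt_ideal)
  have B_mult: "monomial R as \<gamma> \<otimes> x \<in> B (n + sum_list \<gamma>)"
    if "length \<gamma> = length as" "x \<in> B n" for n \<gamma> x
    using filt_mult_monomial[of x "Suc n" \<gamma>] that by (simp add: B_def)
  have fin: "finite_length R (B n) (carrier R)" for n
    unfolding B_def by (rule finite_length_filt[OF assms])
  have eq: "len R (filt R P as (Suc n)) (filt R P as n) = sum g (exps (length as) n)" for n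
  proof -
    have "len R (B n) (Idl (B n \<union> monomial R as ` exps (length as) n)) = sum g (exps (length as) n)"
      unfolding len_adjoin_sorted[OF fin finite_exps monomial_image_closed[OF as]] g_def lead_def
      by (intro sum.cong[OF refl]) (auto simp: exps_def)
    then show ?thesis by (simp add: B_def Idl_filt_gens)
  qed
  have "g \<alpha> \<le> g \<beta>" if le: "length \<alpha> = length as" "exp_le \<beta> \<alpha>" for \<alpha> \<beta>
  proof -
    obtain \<gamma> where \<gamma>: "length \<gamma> = length \<alpha>" "\<alpha> = exp_add \<beta> \<gamma>"
      using exp_le_imp_exp_add le(2) by blast
    have len: "length \<beta> = length as" using le list_all2_lengthD by metis
    have sub: "lead R B as \<beta> \<subseteq> lead R B as \<alpha>"
      unfolding \<gamma>(2) using \<gamma>(1) le(1) len by (intro lead_mono as B B_mult) auto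
    have ids: "ideal (lead R B as \<alpha>) R" "ideal (lead R B as \<beta>) R"
      using as B by (auto intro: lead_ideal)
    have "B (sum_list \<beta>) \<subseteq> lead R B as \<beta>"
    proof
      fix x assume x: "x \<in> B (sum_list \<beta>)"
      have S: "B (sum_list \<beta>) \<union> monomial R as ` {\<delta> \<in> exps (length as) (sum_list \<beta>). \<delta> < \<beta>} \<subseteq> carrier R"
        using ideal_subset_carrier[OF B] as by auto
      have "x \<in> carrier R" using x ideal.Icarr[OF B] by blast
      then show "x \<in> lead R B as \<beta>"
        using x as genideal_self[OF S] ideal.I_l_closed[OF genideal_ideal[OF S]]
        unfolding lead_def mem_colon by auto
    qed
    then have "finite_length R (lead R B as \<beta>) (carrier R)"
      using ids by (intro finite_length_subinterval[OF fin] oneideal ideal_subset_carrier) auto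
    then show ?thesis
      unfolding g_def using ids sub by (intro len_antimono ideal_subset_carrier) auto
  qed
  from eventually_mono_sum_exps[of "length as" g, OF this] show ?thesis unfolding eq .
qed

end

end

section \<open>Noetherian induction and Artin-Rees\<close>

lemma (in noetherian_ring) wf_ideals: "wf {(J, K). ideal J R \<and> ideal K R \<and> K \<subset> J}"
proof (rule wfI_min)
  fix x :: "'a set" and Q assume x: "x \<in> Q"
  show "\<exists>z\<in>Q. \<forall>y. (y, z) \<in> {(J, K). ideal J R \<and> ideal K R \<and> K \<subset> J} \<longrightarrow> y \<notin> Q"
  proof (cases "\<exists>z\<in>Q. ideal z R")
    case True
    \<comment> \<open>Descending in this relation means enlarging the ideal, so an inclusion-maximal
      ideal of Q is wanted; Zorn applies because a nonempty chain of ideals contains its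
      union.\<close>
    have "\<exists>M\<in>{J \<in> Q. ideal J R}. \<forall>X\<in>{J \<in> Q. ideal J R}. M \<subseteq> X \<longrightarrow> X = M"
    proof (rule subset_Zorn_nonempty)
      show "{J \<in> Q. ideal J R} \<noteq> {}" using True by auto
      fix C assume C: "C \<noteq> {}" "subset.chain {J \<in> Q. ideal J R} C"
      then have "subset.chain {I. ideal I R} C" by (auto simp: subset.chain_def)
      then have "\<Union>C \<in> C" using C(1) ideal_chain_is_trivial by blast
      then show "\<Union>C \<in> {J \<in> Q. ideal J R}" using C(2) by (auto simp: subset.chain_def)
    qed
    then show ?thesis by blast
  next
    case False
    with x show ?thesis by blast
  qed
qed

locale noetherian_cring = cring R + noetherian_ring R for R (structure)
begin

text \<open>Leading terms replace the Rees algebra. For the constant family \<bb>, all ideals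
  \<open>lead\<close> occur in degree at most k, so the leading coefficient of x \<in> \<bb>
  \<inter> I^n at \<alpha> also belongs to a divisor \<beta> of degree at most k. Subtracting an
  element of \<bb> times the cofactor monomial, of degree at least n - k, lowers the leading
  monomial of x within the finite set of degree n.\<close>

theorem artin_rees:
  assumes b: "ideal \<bb> R" and as: "set as \<subseteq> carrier R"
  obtains k where
    "\<And>n. \<bb> \<inter> filt R {\<zero>} as n \<subseteq> ideal_prod R (filt R {\<zero>} as (n - k)) \<bb>"
proof -
  define B where "B = (\<lambda>_::nat. \<bb>)"
  let ?m = "monomial R as"
  have Bmult: "?m \<gamma> \<otimes> x \<in> B (n + sum_list \<gamma>)" if "length \<gamma> = length as" "x \<in> B n" for \<gamma> x n
    using that as ideal.I_l_closed[OF b] by (simp add: B_def)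
  have lead: "lead R B as \<beta> = lead R B as \<alpha> \<or>
    (lead R B as \<alpha>, lead R B as \<beta>) \<in> {(J, K). ideal J R \<and> ideal K R \<and> K \<subset> J}"
    if le: "length \<alpha> = length as" "exp_le \<beta> \<alpha>" for \<alpha> \<beta>
  proof -
    obtain \<gamma> where \<gamma>: "length \<gamma> = length \<alpha>" "\<alpha> = exp_add \<beta> \<gamma>"
      using exp_le_imp_exp_add le(2) by blast
    have len: "length \<beta> = length as" using le list_all2_lengthD by metis
    have "lead R B as \<beta> \<subseteq> lead R B as \<alpha>"
      unfolding \<gamma>(2) using \<gamma>(1) le(1) len b Bmult
      by (intro lead_mono as) (auto simp: B_def)
    moreover have "ideal (lead R B as \<alpha>) R" "ideal (lead R B as \<beta>) R"
      using as b by (auto intro!: lead_ideal simp: B_def)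
    ultimately show ?thesis by blast
  qed
  obtain k where k: "\<And>\<alpha>. length \<alpha> = length as \<Longrightarrow>
      \<exists>\<beta>. exp_le \<beta> \<alpha> \<and> sum_list \<beta> \<le> k \<and> lead R B as \<beta> = lead R B as \<alpha>"
    using finite_basis[where T = "lead R B as" and r = "length as", OF wf_ideals lead] by blast
  note Z0 = zeroideal
  have "\<bb> \<inter> filt R {\<zero>} as n \<subseteq> ideal_prod R (filt R {\<zero>} as (n - k)) \<bb>" for n
  proof -
    define Z where "Z = ideal_prod R (filt R {\<zero>} as (n - k)) \<bb>"
    have Z: "ideal Z R" unfolding Z_def by (intro ideal_prod_is_ideal filt_ideal Z0 as b)
    define J where "J S = Idl ({\<zero>} \<union> ?m ` S)" for S
    have J_sub: "{\<zero>} \<union> ?m ` S \<subseteq> carrier R" for S using as by auto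
    have J: "ideal (J S) R" for S unfolding J_def by (rule genideal_ideal[OF J_sub])
    have J_gen: "?m \<alpha> \<in> J S" if "\<alpha> \<in> S" for \<alpha> S
      using that genideal_self[OF J_sub, of S] by (auto simp: J_def)
    \<comment> \<open>S runs through initial segments of the degree n exponents; being closed
      downwards, they contain every exponent that a cancellation can produce.\<close>
    have main: "\<bb> \<inter> J S \<subseteq> Z"
      if "finite S" "S \<subseteq> exps (length as) n"
        "\<And>\<alpha> \<beta>. \<alpha> \<in> S \<Longrightarrow> \<beta> \<in> exps (length as) n \<Longrightarrow> \<beta> < \<alpha> \<Longrightarrow> \<beta> \<in> S" for S
      using that
    proof (induction S rule: finite_linorder_max_induct)
      case empty
      then show ?case using ideal_zero_mem[OF Z] by (auto simp: J_def genideal_zero)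
    next
      case (insert \<alpha> A)
      have A: "A = {\<beta> \<in> exps (length as) n. \<beta> < \<alpha>}"
        using insert.prems insert.hyps(2) by auto
      have \<alpha>: "length \<alpha> = length as" "sum_list \<alpha> = n" using insert.prems(1) by (auto simp: exps_def)
      show ?case
      proof
        fix x assume x: "x \<in> \<bb> \<inter> J (insert \<alpha> A)"
        have "J (insert \<alpha> A) = Idl (insert (?m \<alpha>) (J A))"
          unfolding J_def using Idl_insert_Idl[OF J_sub] as by (simp add: insert_commute)
        also have "\<dots> = adjoin R (J A) (?m \<alpha>) (carrier R)"
          using Idl_insert[OF J] as by simp
        finally obtain w r where wr: "w \<in> J A" "r \<in> carrier R" "x = w \<oplus> ?m \<alpha> \<otimes> r"
          using x unfolding adjoin_def by blast
        have closed: "w \<in> carrier R" "x \<in> carrier R" "?m \<alpha> \<otimes> r \<in> carrier R"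
          using wr x as ideal.Icarr[OF J] ideal.Icarr[OF b] by auto
        have W_sub: "\<bb> \<union> ?m ` A \<subseteq> carrier R" using ideal_subset_carrier[OF b] as by auto
        have JW: "J A \<subseteq> Idl (\<bb> \<union> ?m ` A)"
          unfolding J_def using genideal_self[OF W_sub] genideal_ideal[OF W_sub]
          by (intro genideal_minimal) (auto simp: ideal_zero_mem)
        have "?m \<alpha> \<otimes> r = x \<ominus> w" using wr closed by (simp add: a_minus_def a_comm r_neg1)
        also have "\<dots> \<in> Idl (\<bb> \<union> ?m ` A)"
          using x wr(1) JW genideal_self[OF W_sub] by (intro ideal_sum_closed genideal_ideal W_sub) auto
        finally have "r \<in> lead R B as \<alpha>"
          using wr(2) \<alpha> by (simp add: lead_def mem_colon B_def A)
        moreover obtain \<beta> where \<beta>: "exp_le \<beta> \<alpha>" "sum_list \<beta> \<le> k" "lead R B as \<beta> = lead R B as \<alpha>"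
          using k[OF \<alpha>(1)] by blast
        ultimately have "r \<in> lead R B as \<beta>" by simp
        then have "?m \<beta> \<otimes> r \<in> Idl (\<bb> \<union> ?m ` {\<delta> \<in> exps (length as) (sum_list \<beta>). \<delta> < \<beta>})"
          by (simp add: lead_def mem_colon B_def)
        then obtain y w' where yw: "y \<in> \<bb>" "w' \<in> J {\<delta> \<in> exps (length as) (sum_list \<beta>). \<delta> < \<beta>}"
          "?m \<beta> \<otimes> r = y \<oplus> w'"
          using Idl_Un_decomp[OF b monomial_image_closed[OF as]] unfolding J_def by blast
        obtain \<gamma> where \<gamma>: "length \<gamma> = length \<alpha>" "\<alpha> = exp_add \<beta> \<gamma>"
          using exp_le_imp_exp_add \<beta>(1) by blast
        have len: "length \<beta> = length as" "length \<gamma> = length as"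
          using \<alpha>(1) \<gamma>(1) list_all2_lengthD[OF \<beta>(1)] by simp_all
        have n: "n = sum_list \<beta> + sum_list \<gamma>"
          using sum_list_exp_add[of \<beta> \<gamma>] len \<alpha>(2) unfolding \<gamma>(2) by simp
        have "J {\<delta> \<in> exps (length as) (sum_list \<beta>). \<delta> < \<beta>} \<subseteq> colon R (J A) (?m \<gamma>)"
          unfolding J_def[of "{\<delta> \<in> exps (length as) (sum_list \<beta>). \<delta> < \<beta>}"]
        proof (intro genideal_minimal colon_ideal J monomial_closed[OF as] Un_least)
          show "{\<zero>} \<subseteq> colon R (J A) (?m \<gamma>)"
            using ideal_zero_mem[OF J] as by (simp add: mem_colon)
          show "?m ` {\<delta> \<in> exps (length as) (sum_list \<beta>). \<delta> < \<beta>} \<subseteq> colon R (J A) (?m \<gamma>)"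
          proof (clarsimp simp: mem_colon as)
            fix \<delta> assume \<delta>: "\<delta> \<in> exps (length as) (sum_list \<beta>)" "\<delta> < \<beta>"
            then have "exp_add \<delta> \<gamma> \<in> A"
              unfolding A using exp_add_less_mono[of \<delta> \<beta> \<gamma>] len \<gamma>(2) n
              by (auto simp: exps_def sum_list_exp_add)
            moreover have "?m (exp_add \<delta> \<gamma>) = ?m \<gamma> \<otimes> ?m \<delta>"
              using \<delta> len as by (simp add: exps_def monomial_add m_comm)
            ultimately show "?m \<gamma> \<otimes> ?m \<delta> \<in> J A" using J_gen by metis
          qed
        qed
        with yw(2) have w'': "?m \<gamma> \<otimes> w' \<in> J A" by (auto simp: mem_colon)
        have closed': "y \<in> carrier R" "w' \<in> carrier R" "?m \<gamma> \<in> carrier R" "?m \<beta> \<in> carrier R"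
          using yw ideal.Icarr[OF b] ideal.Icarr[OF J] as by auto
        have "?m \<alpha> \<otimes> r = ?m \<gamma> \<otimes> (?m \<beta> \<otimes> r)"
          using \<gamma>(2) len as wr(2) by (simp add: monomial_add m_ac)
        also have "\<dots> = ?m \<gamma> \<otimes> y \<oplus> ?m \<gamma> \<otimes> w'" using yw(3) closed' by (simp add: r_distr)
        \<comment> \<open>The leading term is traded for \<open>?m \<gamma> \<otimes> y\<close>,
          which lies in the product ideal. The remainder involves only exponents in A and, as a
          difference, is still in \<bb>.\<close>
        finally have x_eq: "x = (w \<oplus> ?m \<gamma> \<otimes> w') \<oplus> ?m \<gamma> \<otimes> y"
          using wr(3) closed closed' by (simp add: a_ac)
        have "?m \<gamma> \<in> filt R {\<zero>} as (sum_list \<gamma>)"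
          using filt_gens(2)[OF Z0 as] len by (auto simp: exps_def)
        moreover have "filt R {\<zero>} as (sum_list \<gamma>) \<subseteq> filt R {\<zero>} as (n - k)"
          using n \<beta>(2) by (intro filt_antimono Z0 as) auto
        ultimately have gy: "?m \<gamma> \<otimes> y \<in> Z"
          unfolding Z_def using yw(1) by (intro ideal_prod.prod) auto
        have "w \<oplus> ?m \<gamma> \<otimes> w' = x \<ominus> ?m \<gamma> \<otimes> y"
          using x_eq closed closed' by (simp add: a_minus_def a_assoc r_neg)
        moreover have "x \<ominus> ?m \<gamma> \<otimes> y \<in> \<bb>"
          using x yw(1) closed' by (intro ideal_sum_closed b ideal.I_l_closed[OF b]) auto
        moreover have "w \<oplus> ?m \<gamma> \<otimes> w' \<in> J A"
          using wr(1) w'' by (intro ideal_sum_closed J)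
        moreover have "\<bb> \<inter> J A \<subseteq> Z"
        proof (rule insert.IH)
          show "A \<subseteq> exps (length as) n" by (auto simp: A)
          show "\<delta>' \<in> A" if "\<delta> \<in> A" "\<delta>' \<in> exps (length as) n" "\<delta>' < \<delta>" for \<delta> \<delta>'
            using that by (auto simp: A intro: less_trans)
        qed
        ultimately have "w \<oplus> ?m \<gamma> \<otimes> w' \<in> Z" by auto
        with gy show "x \<in> Z" unfolding x_eq using ideal_sum_closed(1)[OF Z] by blast
      qed
    qed
    show ?thesis
      using main[OF finite_exps order_refl] unfolding J_def Z_def filt_def by blast
  qed
  with that show thesis by blast
qed

end

section \<open>Nakayama's lemma, prime ideals and Frobenius powers\<close>

lemma (in cring) monomial_mem_ideal_of_gens:
  assumes "ideal J R" "set as \<subseteq> J" "length \<alpha> = length as" "0 < sum_list \<alpha>"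
  shows "monomial R as \<alpha> \<in> J"
proof -
  have "set as \<subseteq> carrier R" using assms(1,2) ideal_subset_carrier by blast
  with assms(2-4) show ?thesis
  proof (induction as arbitrary: \<alpha>)
    case (Cons a as)
    obtain x xs where eq: "\<alpha> = x # xs"
      using Cons.prems by (metis length_Suc_conv list.size(4))
    have closed: "a \<in> carrier R" "monomial R as xs \<in> carrier R" using Cons.prems by auto
    show ?case
    proof (cases x)
      case 0
      then have "monomial R as xs \<in> J" using Cons eq by auto
      then show ?thesis using closed ideal.I_l_closed[OF assms(1)] by (simp add: eq)
    next
      case (Suc y)
      then have "a [^] x \<in> J" using Cons.prems closed ideal.I_l_closed[OF assms(1)] by simp
      then show ?thesis using closed ideal.I_r_closed[OF assms(1)] by (simp add: eq)
    qed
  qed simp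
qed

text \<open>Generators are eliminated one by one: s = u + sx with x \<in> \<mm> gives s(1 - x) = u,
  and 1 - x is a unit, so s already lies in U.\<close>

lemma (in cring) nakayama_mod:
  assumes units: "\<And>x. x \<in> \<mm> \<Longrightarrow> \<one> \<ominus> x \<in> Units R" and m: "ideal \<mm> R" and P: "ideal P R"
    and "finite S" "S \<subseteq> carrier R"
    and "S \<subseteq> Idl (P \<union> {x \<otimes> s |x s. x \<in> \<mm> \<and> s \<in> S})"
  shows "S \<subseteq> P"
  using assms(4-6)
proof (induction S rule: finite_induct)
  case (insert s S)
  define U where "U = Idl (P \<union> {x \<otimes> s |x s. x \<in> \<mm> \<and> s \<in> S})"
  have sub: "P \<union> {x \<otimes> s |x s. x \<in> \<mm> \<and> s \<in> S} \<subseteq> carrier R"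
    using ideal_subset_carrier[OF P] ideal_subset_carrier[OF m] insert.prems(1) by auto
  have s: "s \<in> carrier R" using insert.prems by simp
  have U: "ideal U R" "P \<subseteq> U" "\<And>x s. x \<in> \<mm> \<Longrightarrow> s \<in> S \<Longrightarrow> x \<otimes> s \<in> U"
    using genideal_ideal[OF sub] genideal_self[OF sub] by (auto simp: U_def)
  have U_adj: "u \<in> adjoin R U s \<mm>" if "u \<in> U" for u
  proof -
    have "u = u \<oplus> s \<otimes> \<zero>" using that s ideal.Icarr[OF U(1)] by simp
    then show ?thesis using that ideal_zero_mem[OF m] unfolding adjoin_def by blast
  qed
  have s_adj: "x \<otimes> s \<in> adjoin R U s \<mm>" if "x \<in> \<mm>" for x
  proof -
    have "x \<otimes> s = \<zero> \<oplus> s \<otimes> x" using that s ideal.Icarr[OF m] by (simp add: m_comm)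
    then show ?thesis using that ideal_zero_mem[OF U(1)] unfolding adjoin_def by blast
  qed
  have "Idl (P \<union> {x \<otimes> t |x t. x \<in> \<mm> \<and> t \<in> insert s S}) \<subseteq> adjoin R U s \<mm>"
    using U U_adj s_adj by (intro genideal_minimal adjoin_ideal m s) auto
  then have adj: "insert s S \<subseteq> adjoin R U s \<mm>" using insert.prems(2) by blast
  then obtain u x where ux: "u \<in> U" "x \<in> \<mm>" "s = u \<oplus> s \<otimes> x"
    unfolding adjoin_def by blast
  have closed: "u \<in> carrier R" "x \<in> carrier R"
    using ux ideal.Icarr[OF U(1)] ideal.Icarr[OF m] by auto
  have "s \<otimes> (\<one> \<ominus> x) = s \<ominus> s \<otimes> x"
    using s closed by (simp add: a_minus_def r_distr r_minus)
  also have "\<dots> = u"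
    using arg_cong[OF ux(3), of "\<lambda>y. y \<ominus> s \<otimes> x"] s closed by (simp add: a_minus_def a_assoc r_neg)
  finally have su: "s \<otimes> (\<one> \<ominus> x) = u" .
  have un: "\<one> \<ominus> x \<in> Units R" using units ux by blast
  have "s = s \<otimes> (\<one> \<ominus> x) \<otimes> inv (\<one> \<ominus> x)"
    using s un Units_closed by (simp add: m_assoc)
  also have "\<dots> \<in> U" unfolding su using ux(1) un ideal.I_r_closed[OF U(1)] by simp
  finally have sU: "s \<in> U" .
  then have "adjoin R U s \<mm> \<subseteq> U"
    unfolding adjoin_def using ideal_sum_closed(1)[OF U(1)] ideal.I_r_closed[OF U(1)] ideal.Icarr[OF m]
    by auto
  with adj insert have "S \<subseteq> P" unfolding U_def by blast
  then have "U \<subseteq> P"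
    unfolding U_def using ideal.I_l_closed[OF P] ideal.Icarr[OF m]
    by (intro genideal_minimal P) auto
  with sU \<open>S \<subseteq> P\<close> show ?case by auto
qed simp

text \<open>Additivity along 0 \<rightarrow> R/(J : c) \<rightarrow> R/J \<rightarrow> R/(J + cR)
  \<rightarrow> 0, the first map being multiplication by c.\<close>

lemma (in cring) len_colon:
  assumes "finite_length R J (carrier R)" "c \<in> carrier R"
  shows "len R J (carrier R) = len R (colon R J c) (carrier R) + len R (Idl (insert c J)) (carrier R)"
    and "finite_length R (colon R J c) (carrier R)"
proof -
  have J: "ideal J R" "J \<subseteq> carrier R" using assms(1) by (auto simp: finite_length_def)
  have "J \<subseteq> colon R J c"
    using assms(2) J(2) ideal.I_l_closed[OF J(1)] by (auto simp: mem_colon)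
  then show fin: "finite_length R (colon R J c) (carrier R)"
    by (intro finite_length_subinterval[OF assms(1)] colon_ideal oneideal J assms(2) ideal_subset_carrier)
      auto
  have sub: "insert c J \<subseteq> carrier R" using assms(2) J(2) by simp
  have "len R J (carrier R) = len R J (Idl (insert c J)) + len R (Idl (insert c J)) (carrier R)"
    using genideal_self[OF sub]
    by (intro len_add assms(1) genideal_ideal sub ideal_subset_carrier) auto
  then show "len R J (carrier R) = len R (colon R J c) (carrier R) + len R (Idl (insert c J)) (carrier R)"
    using len_insert(2)[OF J(1) assms(2) fin] by simp
qed

lemma (in cring) one_notin_prime:
  assumes "primeideal P R"
  shows "\<one> \<notin> P"
  using ideal.one_imp_carrier[OF primeideal.axioms(1)[OF assms]] primeideal.I_notcarr[OF assms] by auto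

lemma (in cring) prime_pow_mem:
  assumes "primeideal P R" "a \<in> carrier R" "a [^] (n::nat) \<in> P"
  shows "a \<in> P"
  using assms(3)
proof (induction n)
  case 0
  then show ?case using one_notin_prime[OF assms(1)] by simp
next
  case (Suc n)
  then show ?case using primeideal.I_prime[OF assms(1), of "a [^] n" a] assms(2) by auto
qed

lemma (in cring) pow_mem_ideals_pow:
  assumes "ideal I R" "a \<in> I"
  shows "a [^] (n::nat) \<in> I [^]\<^bsub>ideals_set R\<^esub> n"
proof (induction n)
  case 0
  then show ?case by (simp add: ideals_set_def)
next
  case (Suc n)
  then show ?case using assms(2) by (simp add: ideals_set_def ideal_prod.prod)
qed

lemma (in cring) monomial_mem_ideals_pow:
  assumes "ideal I R" "set as \<subseteq> I" "length \<alpha> = length as"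
  shows "monomial R as \<alpha> \<in> I [^]\<^bsub>ideals_set R\<^esub> sum_list \<alpha>"
  using assms(2,3)
proof (induction as arbitrary: \<alpha>)
  case Nil
  then show ?case by (simp add: ideals_set_def)
next
  case (Cons a as)
  interpret S: comm_monoid "ideals_set R" by (rule ideals_set_is_comm_monoid)
  obtain x xs where eq: "\<alpha> = x # xs"
    using Cons.prems by (metis length_Suc_conv list.size(4))
  have "I \<in> carrier (ideals_set R)" using assms(1) by (simp add: ideals_set_def)
  then have pow: "I [^]\<^bsub>ideals_set R\<^esub> sum_list \<alpha> =
    ideal_prod R (I [^]\<^bsub>ideals_set R\<^esub> x) (I [^]\<^bsub>ideals_set R\<^esub> sum_list xs)"
    using S.nat_pow_mult[of I x "sum_list xs"] by (simp add: eq ideals_set_def)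
  have "monomial R as xs \<in> I [^]\<^bsub>ideals_set R\<^esub> sum_list xs" using Cons eq by auto
  moreover have "a [^] x \<in> I [^]\<^bsub>ideals_set R\<^esub> x"
    using Cons.prems assms(1) pow_mem_ideals_pow by simp
  ultimately show ?case unfolding pow by (simp add: eq ideal_prod.prod)
qed

lemma (in cring) frobenius_iterate:
  fixes p e :: nat
  assumes "(\<lambda>x. x [^] p) \<in> ring_hom R R" "x \<in> carrier R" "y \<in> carrier R"
  shows "(x \<oplus> y) [^] (p ^ e) = x [^] (p ^ e) \<oplus> y [^] (p ^ e)"
proof (induction e)
  case 0
  then show ?case using assms by simp
next
  case (Suc e)
  have step: "z [^] (p ^ Suc e) = (z [^] (p ^ e)) [^] p" if "z \<in> carrier R" for z
    using that by (simp add: nat_pow_pow mult.commute)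
  show ?case
    using assms Suc ring_hom_add[OF assms(1)] by (simp add: step del: power_Suc)
qed

text \<open>It allows inclusions of bracket powers to be checked on generators only.\<close>

lemma (in cring) frobenius_preimage_ideal:
  fixes p e :: nat
  assumes "(\<lambda>x. x [^] p) \<in> ring_hom R R" "0 < p" "ideal J R"
  shows "ideal {x \<in> carrier R. x [^] (p ^ e) \<in> J} R"
proof (rule ideal_criterion)
  show "\<zero> \<in> {x \<in> carrier R. x [^] (p ^ e) \<in> J}"
    using assms(2) ideal_zero_mem[OF assms(3)] by (simp add: nat_pow_zero)
  show "x \<oplus> y \<in> {x \<in> carrier R. x [^] (p ^ e) \<in> J}"
    if "x \<in> {x \<in> carrier R. x [^] (p ^ e) \<in> J}" "y \<in> {x \<in> carrier R. x [^] (p ^ e) \<in> J}" for x y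
    using that frobenius_iterate[OF assms(1)] ideal_sum_closed(1)[OF assms(3)] by simp
  show "r \<otimes> x \<in> {x \<in> carrier R. x [^] (p ^ e) \<in> J}"
    if "r \<in> carrier R" "x \<in> {x \<in> carrier R. x [^] (p ^ e) \<in> J}" for r x
    using that ideal.I_l_closed[OF assms(3)] by (simp add: nat_pow_distrib)
qed auto

text \<open>Pulling back twice along Frobenius reduces the inclusion to generators. The target needs
  no more generators than A has elements, whatever the exponent; the factor \<mu> in the length
  bound rests on this.\<close>

lemma (in cring) bracket_power_iterate:
  fixes p e f :: nat
  assumes frob: "(\<lambda>x. x [^] p) \<in> ring_hom R R" and "0 < p" and A: "A \<subseteq> carrier R"
  shows "bracket_power R (bracket_power R (Idl A) (p ^ f)) (p ^ e) \<subseteq> Idl ((\<lambda>a. a [^] (p ^ f * p ^ e)) ` A)"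
proof -
  have sub: "(\<lambda>a. a [^] Q) ` A \<subseteq> carrier R" for Q :: nat using A by auto
  define T where "T Q = Idl ((\<lambda>a. a [^] Q) ` A)" for Q :: nat
  have T: "ideal (T Q) R" "\<And>a. a \<in> A \<Longrightarrow> a [^] Q \<in> T Q" for Q
    using genideal_ideal[OF sub] genideal_self[OF sub] by (auto simp: T_def)
  have "Idl A \<subseteq> {x \<in> carrier R. x [^] (p ^ f) \<in> T (p ^ f)}"
    using A T by (intro genideal_minimal frobenius_preimage_ideal[OF frob \<open>0 < p\<close>]) auto
  then have 1: "bracket_power R (Idl A) (p ^ f) \<subseteq> T (p ^ f)"
    unfolding bracket_power_def using T by (intro genideal_minimal) auto
  have "T (p ^ f) \<subseteq> {x \<in> carrier R. x [^] (p ^ e) \<in> T (p ^ f * p ^ e)}"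
    unfolding T_def[of "p ^ f"]
  proof (intro genideal_minimal frobenius_preimage_ideal[OF frob \<open>0 < p\<close>] T)
    show "(\<lambda>a. a [^] (p ^ f)) ` A \<subseteq> {x \<in> carrier R. x [^] (p ^ e) \<in> T (p ^ f * p ^ e)}"
      using A T(2) by (auto simp: nat_pow_pow)
  qed
  with 1 have "bracket_power R (bracket_power R (Idl A) (p ^ f)) (p ^ e) \<subseteq> T (p ^ f * p ^ e)"
    unfolding bracket_power_def[of R _ "p ^ e"] using T by (intro genideal_minimal) auto
  then show ?thesis by (simp add: T_def)
qed

section \<open>Artin-Rees and strict filtrations modulo a prime\<close>

context noetherian_cring
begin

text \<open>If cx = y + v with y \<in> P and v \<in> I^n, then v lies in \<bb> = P + cR, so
  Artin-Rees gives v \<in> P + c I^(n - k). Since P is prime, c cancels modulo P and leaves x \<in>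
  P + I^(n - k).\<close>

lemma colon_filt_subset:
  assumes P: "primeideal P R" and as: "set as \<subseteq> carrier R" and c: "c \<in> carrier R" "c \<notin> P"
  obtains k where "\<And>n. colon R (filt R P as n) c \<subseteq> filt R P as (n - k)"
proof -
  have Pi: "ideal P R" using P by (rule primeideal.axioms(1))
  note Z0 = zeroideal
  define \<bb> where "\<bb> = adjoin R P c (carrier R)"
  have b: "ideal \<bb> R" unfolding \<bb>_def by (intro adjoin_ideal Pi oneideal c)
  obtain k where k: "\<And>n. \<bb> \<inter> filt R {\<zero>} as n \<subseteq> ideal_prod R (filt R {\<zero>} as (n - k)) \<bb>"
    using artin_rees[OF b as] by blast
  have "colon R (filt R P as n) c \<subseteq> filt R P as (n - k)" for n
  proof
    define V where "V = filt R {\<zero>} as (n - k)"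
    have V: "ideal V R" unfolding V_def by (intro filt_ideal Z0 as)
    fix x assume "x \<in> colon R (filt R P as n) c"
    then have x: "x \<in> carrier R" "c \<otimes> x \<in> filt R P as n" by (auto simp: mem_colon)
    then obtain y v where yv: "y \<in> P" "v \<in> filt R {\<zero>} as n" "c \<otimes> x = y \<oplus> v"
      using Idl_Un_decomp[OF Pi monomial_image_closed[OF as]] unfolding filt_def by blast
    have closed: "y \<in> carrier R" "v \<in> carrier R"
      using yv ideal.Icarr[OF Pi] ideal.Icarr[OF filt_ideal[OF Z0 as]] by auto
    have "v = \<ominus> y \<oplus> c \<otimes> x" unfolding yv(3) using closed by (simp add: a_assoc[symmetric] l_neg)
    then have "v \<in> \<bb>"
      unfolding \<bb>_def adjoin_def using x(1) ideal_sum_closed(3)[OF Pi yv(1) yv(1)] by blast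
    with k[of n] yv(2) have "v \<in> ideal_prod R V \<bb>" by (auto simp: V_def)
    moreover have "ideal_prod R V \<bb> \<subseteq> adjoin R P c V"
    proof
      fix z assume "z \<in> ideal_prod R V \<bb>"
      then show "z \<in> adjoin R P c V"
      proof (induction z rule: ideal_prod.induct)
        case (prod i j)
        then obtain y' r where yr: "y' \<in> P" "r \<in> carrier R" "j = y' \<oplus> c \<otimes> r"
          unfolding \<bb>_def adjoin_def by blast
        have i: "i \<in> carrier R" using prod ideal.Icarr[OF V] by blast
        have "i \<otimes> j = i \<otimes> y' \<oplus> c \<otimes> (i \<otimes> r)"
          using i yr c ideal.Icarr[OF Pi] by (simp add: r_distr m_lcomm[of i c r])
        moreover have "i \<otimes> y' \<in> P" "i \<otimes> r \<in> V"
          using i yr prod(1) ideal.I_l_closed[OF Pi] ideal.I_r_closed[OF V] by auto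
        ultimately show ?case unfolding adjoin_def by blast
      next
        case (sum s1 s2)
        then show ?case using ideal_sum_closed(1)[OF adjoin_ideal[OF Pi V c(1)]] by blast
      qed
    qed
    ultimately obtain y' w where yw: "y' \<in> P" "w \<in> V" "v = y' \<oplus> c \<otimes> w"
      unfolding adjoin_def by blast
    have closed': "y' \<in> carrier R" "w \<in> carrier R"
      using yw ideal.Icarr[OF Pi] ideal.Icarr[OF V] by auto
    have "c \<otimes> (x \<ominus> w) = c \<otimes> x \<ominus> c \<otimes> w"
      using x c closed' by (simp add: a_minus_def r_distr r_minus)
    also have "\<dots> = y \<oplus> y'"
      unfolding yv(3) yw(3) using closed closed' c by (simp add: a_minus_def a_assoc r_neg)
    also have "\<dots> \<in> P" using yv(1) yw(1) ideal_sum_closed(1)[OF Pi] by blast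
    finally have "c \<otimes> (x \<ominus> w) \<in> P" .
    then have "x \<ominus> w \<in> P"
      using primeideal.I_prime[OF P] c x closed' by blast
    then have "x \<ominus> w \<in> filt R P as (n - k)" using filt_gens(1)[OF Pi as] by blast
    moreover have "w \<in> filt R P as (n - k)"
    proof -
      have "V \<subseteq> filt R P as (n - k)"
        unfolding V_def
        using filt_gens(1)[OF Pi as] subsetD[OF filt_gens(2)[OF Pi as]]
          ideal_zero_mem[OF filt_ideal[OF Pi as]]
        by (intro filt_minimal Z0 as filt_ideal Pi) auto
      with yw(2) show ?thesis by blast
    qed
    ultimately have "(x \<ominus> w) \<oplus> w \<in> filt R P as (n - k)"
      using ideal_sum_closed(1)[OF filt_ideal[OF Pi as]] by blast
    then show "x \<in> filt R P as (n - k)"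
      using x closed' by (simp add: a_minus_def a_assoc l_neg)
  qed
  with that show thesis by blast
qed

lemma exists_maximalideal:
  assumes "ideal J R" "J \<noteq> carrier R"
  obtains M where "maximalideal M R" "J \<subseteq> M"
proof -
  let ?Q = "{K. ideal K R \<and> K \<noteq> carrier R \<and> J \<subseteq> K}"
  have "J \<in> ?Q" using assms by simp
  obtain M where M: "M \<in> ?Q"
    and min: "\<And>K. (K, M) \<in> {(J, K). ideal J R \<and> ideal K R \<and> K \<subset> J} \<Longrightarrow> K \<notin> ?Q"
    by (rule wfE_min[OF wf_ideals \<open>J \<in> ?Q\<close>]) blast
  have "maximalideal M R"
  proof (rule maximalidealI)
    fix K assume K: "ideal K R" "M \<subseteq> K"
    show "K = M \<or> K = carrier R"
    proof (rule ccontr)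
      assume "\<not> ?thesis"
      with K M have "(K, M) \<in> {(J, K). ideal J R \<and> ideal K R \<and> K \<subset> J}" "K \<in> ?Q" by auto
      with min show False by blast
    qed
  qed (use M in auto)
  then show thesis using M by (intro that) auto
qed

text \<open>R/\<mm> has length at most 1, so every R/\<mm>^n has finite length by the filtration
  argument with P = {0}; and some \<mm>^n lies in I, as each of finitely many generators of \<mm>
  has a power in I.\<close>

lemma finite_length_primary:
  assumes loc: "{J. maximalideal J R} = {\<mm>}" and I: "ideal I R" and rad: "radical R I = \<mm>"
  shows "finite_length R I (carrier R)"
proof -
  have m: "maximalideal \<mm> R" using loc by blast
  have mi: "ideal \<mm> R" using m by (rule maximalideal.axioms(1))
  note Z0 = zeroideal
  obtain M where M: "M \<subseteq> carrier R" "finite M" "\<mm> = Idl M" using finetely_gen[OF mi] by blast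
  obtain ms where ms: "set ms = M" using M(2) finite_list by blast
  have msc: "set ms \<subseteq> carrier R" using ms M by simp
  have "ideal_chain R \<mm> n A \<Longrightarrow> (A = \<mm> \<and> n = 0) \<or> (A = carrier R \<and> n \<le> 1)" for n A
  proof (induction rule: ideal_chain.induct)
    case (strict n A A')
    have "A' \<subseteq> carrier R" using strict.hyps(3) by (rule ideal_subset_carrier)
    with strict have "A = \<mm>" "n = 0" by auto
    moreover have "A' = carrier R"
      using maximalideal.I_maximal[OF m strict.hyps(3)] strict.hyps(2) \<open>A = \<mm>\<close> \<open>A' \<subseteq> carrier R\<close> by blast
    ultimately show ?case by simp
  next
    case (weak n A A')
    have "A' \<subseteq> carrier R" using weak.hyps(3) by (rule ideal_subset_carrier)
    then have "A' = \<mm> \<or> A' = carrier R" if "\<mm> \<subseteq> A'"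
      using maximalideal.I_maximal[OF m weak.hyps(3) that] by blast
    with weak \<open>A' \<subseteq> carrier R\<close> show ?case by auto
  qed simp
  then have "\<forall>n. ideal_chain R \<mm> n (carrier R) \<longrightarrow> n \<le> 1" by fastforce
  then have fin_m: "finite_length R \<mm> (carrier R)"
    unfolding finite_length_def using mi oneideal ideal_subset_carrier by blast
  have "\<mm> \<subseteq> filt R {\<zero>} ms 1"
    unfolding M(3) using monomial_unit[OF msc] filt_gens(2)[OF Z0 msc, of 1] ms
    by (intro genideal_minimal filt_ideal Z0 msc) force
  then have "finite_length R (filt R {\<zero>} ms 1) (carrier R)"
    using ideal_subset_carrier[OF filt_ideal[OF Z0 msc]]
    by (intro finite_length_subinterval[OF fin_m] filt_ideal Z0 msc oneideal) auto
  then have fin: "finite_length R (filt R {\<zero>} ms n) (carrier R)" for n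
    by (rule finite_length_filt[OF Z0 msc])
  have "\<forall>x\<in>M. \<exists>n::nat. x [^] n \<in> I"
    using rad genideal_self[OF M(1)] M(3) by (auto simp: radical_def)
  then obtain e :: "'a \<Rightarrow> nat" where e: "\<And>x. x \<in> M \<Longrightarrow> x [^] e x \<in> I" by metis
  define E where "E = (\<Sum>x\<in>M. e x)"
  have E: "x [^] E \<in> I" if "x \<in> M" for x
  proof -
    have "e x \<le> E" unfolding E_def using that M(2) by (intro member_le_sum) auto
    then have "x [^] E = x [^] (E - e x) \<otimes> x [^] e x" using that M(1) by (auto simp: nat_pow_mult)
    then show ?thesis using e[OF that] that M(1) ideal.I_l_closed[OF I] by auto
  qed
  have "filt R {\<zero>} ms (length ms * E + 1) \<subseteq> I"
  proof (rule filt_minimal[OF Z0 msc I])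
    show "{\<zero>} \<subseteq> I" using ideal_zero_mem[OF I] by simp
    show "monomial R ms \<alpha> \<in> I" if "\<alpha> \<in> exps (length ms) (length ms * E + 1)" for \<alpha>
      using that E ms by (intro monomial_mem_ideal_of_powers[OF I msc]) (auto simp: exps_def)
  qed
  then show ?thesis
    by (intro finite_length_subinterval[OF fin] I oneideal ideal_subset_carrier) auto
qed

text \<open>Equality would place the degree n monomials in P plus \<mm> times themselves. Nakayama
  puts them into P, so a^n \<in> P for every generator a, and P is prime.\<close>

lemma filt_strict:
  assumes loc: "{J. maximalideal J R} = {\<mm>}" and P: "primeideal P R"
    and as: "set as \<subseteq> \<mm>" "\<not> set as \<subseteq> P"
  shows "filt R P as (Suc n) \<subset> filt R P as n"
proof (rule psubsetI)
  have m: "maximalideal \<mm> R" using loc by blast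
  have mi: "ideal \<mm> R" using m by (rule maximalideal.axioms(1))
  have Pi: "ideal P R" using P by (rule primeideal.axioms(1))
  have asc: "set as \<subseteq> carrier R" using as(1) ideal_subset_carrier[OF mi] by blast
  show "filt R P as (Suc n) \<subseteq> filt R P as n" by (rule filt_antimono[OF Pi asc]) simp
  show "filt R P as (Suc n) \<noteq> filt R P as n"
  proof
    assume eq: "filt R P as (Suc n) = filt R P as n"
    have units: "\<one> \<ominus> x \<in> Units R" if x: "x \<in> \<mm>" for x
    proof (rule ccontr)
      assume nu: "\<one> \<ominus> x \<notin> Units R"
      have xc: "x \<in> carrier R" using x ideal.Icarr[OF mi] by blast
      have id: "ideal (PIdl (\<one> \<ominus> x)) R" using xc by (intro cgenideal_ideal) simp
      have "PIdl (\<one> \<ominus> x) \<noteq> carrier R"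
      proof
        assume "PIdl (\<one> \<ominus> x) = carrier R"
        then have "\<one> \<in> PIdl (\<one> \<ominus> x)" by simp
        then obtain y where y: "y \<in> carrier R" "\<one> = y \<otimes> (\<one> \<ominus> x)" unfolding cgenideal_def by blast
        moreover have "(\<one> \<ominus> x) \<otimes> y = y \<otimes> (\<one> \<ominus> x)" using y(1) xc by (intro m_comm) auto
        ultimately have "\<one> \<ominus> x \<in> Units R" using y xc unfolding Units_def by force
        with nu show False ..
      qed
      with id obtain M where "maximalideal M R" "PIdl (\<one> \<ominus> x) \<subseteq> M" by (rule exists_maximalideal)
      then have "\<one> \<ominus> x \<in> \<mm>" using loc xc cgenideal_self[of "\<one> \<ominus> x"] by auto
      then have "(\<one> \<ominus> x) \<oplus> x \<in> \<mm>" using x ideal_sum_closed(1)[OF mi] by blast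
      then have "\<one> \<in> \<mm>" using xc by (simp add: a_minus_def a_assoc l_neg)
      then show False
        using ideal.one_imp_carrier[OF mi] maximalideal.I_notcarr[OF m] by simp
    qed
    define S where "S = monomial R as ` exps (length as) n"
    have Sc: "S \<subseteq> carrier R" unfolding S_def by (rule monomial_image_closed[OF asc])
    have sub: "P \<union> {x \<otimes> s |x s. x \<in> \<mm> \<and> s \<in> S} \<subseteq> carrier R"
      using ideal_subset_carrier[OF Pi] ideal_subset_carrier[OF mi] Sc by auto
    have "filt R P as (Suc n) \<subseteq> Idl (P \<union> {x \<otimes> s |x s. x \<in> \<mm> \<and> s \<in> S})"
    proof (rule filt_minimal[OF Pi asc genideal_ideal[OF sub]])
      show "P \<subseteq> Idl (P \<union> {x \<otimes> s |x s. x \<in> \<mm> \<and> s \<in> S})" using genideal_self[OF sub] by blast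
      fix \<alpha> assume \<alpha>: "\<alpha> \<in> exps (length as) (Suc n)"
      then obtain \<beta> where \<beta>: "exp_le \<beta> \<alpha>" "sum_list \<beta> = n"
        using exp_truncate[of n \<alpha>] by (auto simp: exps_def)
      then obtain \<gamma> where \<gamma>: "length \<gamma> = length \<alpha>" "\<alpha> = exp_add \<beta> \<gamma>"
        using exp_le_imp_exp_add by blast
      have len: "length \<beta> = length as" "length \<gamma> = length as"
        using \<alpha> \<gamma>(1) list_all2_lengthD[OF \<beta>(1)] by (simp_all add: exps_def)
      have "sum_list \<gamma> = 1"
        using sum_list_exp_add[of \<beta> \<gamma>] \<alpha> \<beta>(2) len unfolding \<gamma>(2) exps_def by simp
      then have "monomial R as \<gamma> \<in> \<mm>"
        using len by (intro monomial_mem_ideal_of_gens mi as(1)) auto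
      moreover have "monomial R as \<beta> \<in> S" using len \<beta>(2) by (auto simp: S_def exps_def)
      moreover have "monomial R as \<alpha> = monomial R as \<gamma> \<otimes> monomial R as \<beta>"
        using \<gamma>(2) len asc by (simp add: monomial_add m_comm)
      ultimately show "monomial R as \<alpha> \<in> Idl (P \<union> {x \<otimes> s |x s. x \<in> \<mm> \<and> s \<in> S})"
        using genideal_self[OF sub] by blast
    qed
    then have "S \<subseteq> Idl (P \<union> {x \<otimes> s |x s. x \<in> \<mm> \<and> s \<in> S})"
      unfolding eq S_def using filt_gens(2)[OF Pi asc] by blast
    then have SP: "S \<subseteq> P"
      by (intro nakayama_mod[OF units mi Pi _ Sc]) (auto simp: S_def finite_exps)
    have "a \<in> P" if a: "a \<in> set as" for a
    proof -
      obtain \<epsilon> where \<epsilon>: "\<epsilon> \<in> exps (length as) 1" "monomial R as \<epsilon> = a"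
        using monomial_unit[OF asc a] by blast
      have "map (\<lambda>i. i * n) \<epsilon> \<in> exps (length as) n"
        using \<epsilon>(1) by (auto simp: exps_def sum_list_mult_const)
      then have "monomial R as (map (\<lambda>i. i * n) \<epsilon>) \<in> P" using SP unfolding S_def by blast
      then have "a [^] n \<in> P"
        using monomial_scale[OF asc, of \<epsilon> n] \<epsilon> by (simp add: exps_def)
      then show ?thesis using prime_pow_mem[OF P] a asc by blast
    qed
    with as(2) show False by blast
  qed
qed

end

section \<open>Comparison of lengths\<close>

text \<open>Here p^a plays the role of C. By \<open>quadratic\<close>, L gains at least n over the
  last k1 steps, so \<open>h\<close> grows at least linearly. The thresholds e0 and k are arbitrary;
  what matters is the size of f relative to a.\<close>

lemma growth_contradiction:
  fixes h L :: "nat \<Rightarrow> nat"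
  assumes L: "\<And>n. L n = (\<Sum>j<n. h j)"
    and mono: "\<And>n. n0 \<le> n \<Longrightarrow> h n \<le> h (Suc n)"
    and quadratic: "\<And>n. k1 \<le> n \<Longrightarrow> n + L (n - k1) \<le> L n"
    and bound: "\<And>e s. e0 \<le> e \<Longrightarrow> k \<le> s \<Longrightarrow>
      L (p ^ f * p ^ e + s - k) \<le> L ((p ^ f + \<mu>) * p ^ e) + \<mu> * L s"
    and "2 \<le> p" "1 \<le> \<mu>" "2 * \<mu> + 2 \<le> p ^ a" "2 * a + 1 \<le> f"
  shows False
proof -
  have mono': "n0 \<le> m \<Longrightarrow> m \<le> n \<Longrightarrow> h m \<le> h n" for m n
    by (rule dec_induct[of m n]) (auto intro: order_trans[OF _ mono])
  have L_add: "L (m + l) = L m + (\<Sum>j=m..<m + l. h j)" for m l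
    unfolding L lessThan_atLeast0 by (simp add: sum.atLeastLessThan_concat)
  have L_upper: "L (m + l) \<le> L m + l * h (m + l)" if "n0 \<le> m" for m l
    using sum_bounded_above[of "{m..<m + l}" h "h (m + l)"] mono' that
    by (auto simp: L_add)
  have L_lower: "L m + l * h m \<le> L (m + l)" if "n0 \<le> m" for m l
    using sum_bounded_below[of "{m..<m + l}" "h m" h] mono' that
    by (auto simp: L_add)
  have h_lower: "n \<le> k1 * h n" if "n0 + k1 \<le> n" for n
  proof -
    have "n + L (n - k1) \<le> L n" using quadratic that by simp
    also have "L n \<le> L (n - k1) + k1 * h n" using L_upper[of "n - k1" k1] that by simp
    finally show ?thesis by simp
  qed
  \<comment> \<open>Past this threshold u = p^e exceeds n0, k and L n0 together, so all lower-order
    terms fit into a multiple of u.\<close>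
  define u0 where "u0 = e0 + n0 + k1 + k + L n0 + 1"
  have p_exp: "e < p ^ e" for e
    using order.strict_trans2[OF less_exp power_mono[OF \<open>2 \<le> p\<close>, of e]] by simp
  have key: "h (p ^ (f + e)) \<le> p ^ a * h (p ^ (a + e))" if e: "u0 \<le> e" for e
  proof -
    define u where "u = p ^ e"
    have u: "u0 < u" using p_exp[of e] e by (simp add: u_def)
    define Q where "Q = (p ^ f + \<mu>) * u"
    have pf: "1 \<le> p ^ f" using \<open>2 \<le> p\<close> by simp
    have uQ: "p ^ f * u \<le> Q" by (simp add: Q_def)
    have "u \<le> p ^ f * u" using pf by simp
    with uQ u have Qn: "n0 \<le> Q" unfolding u0_def by linarith
    \<comment> \<open>With this s the index p^f u + s - k equals Q + \<mu>u. Beyond Q the function L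
      gains at least \<mu>u h(Q), and \<mu> cancels against \<mu> L(s).\<close>
    define s where "s = 2 * \<mu> * u + k"
    have s_le: "s \<le> p ^ a * u"
    proof -
      have "s \<le> (2 * \<mu> + 2) * u" using u by (simp add: s_def u0_def)
      also have "\<dots> \<le> p ^ a * u" using assms(7) by (rule mult_right_mono) simp
      finally show ?thesis .
    qed
    have "u \<le> \<mu> * u" using \<open>1 \<le> \<mu>\<close> by simp
    then have "u \<le> s" unfolding s_def mult.assoc by linarith
    with u have s_ge: "u \<le> s" "n0 \<le> s" unfolding u0_def by linarith+
    have "L Q + \<mu> * u * h Q \<le> L (Q + \<mu> * u)" using L_lower[OF Qn] .
    also have "Q + \<mu> * u = p ^ f * u + s - k" by (simp add: Q_def s_def algebra_simps)
    also have "L \<dots> \<le> L Q + \<mu> * L s"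
      unfolding Q_def u_def using e by (intro bound) (auto simp: u0_def s_def)
    finally have "\<mu> * (u * h Q) \<le> \<mu> * L s" by (simp add: mult.assoc)
    then have "u * h Q \<le> L s" using \<open>1 \<le> \<mu>\<close> by simp
    also have "L s \<le> L n0 + (s - n0) * h s"
      using L_upper[of n0 "s - n0"] s_ge by simp
    \<comment> \<open>Linear growth makes \<open>h s\<close> positive, which absorbs the constant L
      n0.\<close>
    also have "\<dots> \<le> L n0 * h s + (s - n0) * h s"
    proof -
      have "0 < h s" using h_lower[of s] s_ge u by (cases "h s") (auto simp: u0_def)
      then show ?thesis by simp
    qed
    also have "\<dots> \<le> (2 * \<mu> + 2) * u * h s"
    proof -
      have "L n0 + (s - n0) \<le> (2 * \<mu> + 2) * u" using u by (simp add: s_def u0_def)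
      then show ?thesis by (metis add_mult_distrib mult_le_mono1)
    qed
    also have "\<dots> \<le> p ^ a * u * h (p ^ a * u)"
      using assms(7) mono'[OF s_ge(2) s_le] by (intro mult_mono) auto
    finally have "u * h Q \<le> u * (p ^ a * h (p ^ a * u))" by (simp add: ac_simps)
    then have "h Q \<le> p ^ a * h (p ^ a * u)" using u by simp
    moreover have "h (p ^ f * u) \<le> h Q"
    proof (rule mono'[OF _ uQ])
      show "n0 \<le> p ^ f * u"
        using u \<open>u \<le> p ^ f * u\<close> unfolding u0_def by linarith
    qed
    ultimately show ?thesis by (simp add: u_def power_add)
  qed
  \<comment> \<open>Each use of \<open>key\<close> multiplies the index by p^g and the value by at
    most p^a; f \<ge> 2a + 1 makes g exceed a.\<close>
  define g where "g = f - a"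
  have g: "a + 1 \<le> g" "f = a + g" using assms(8) by (auto simp: g_def)
  have iterate: "h (p ^ (a + u0 + j * g)) \<le> p ^ (a * j) * h (p ^ (a + u0))" for j
  proof (induction j)
    case (Suc j)
    have "h (p ^ (a + u0 + Suc j * g)) = h (p ^ (f + (u0 + j * g)))"
      by (simp add: g ac_simps)
    also have "\<dots> \<le> p ^ a * h (p ^ (a + (u0 + j * g)))" by (rule key) simp
    also have "\<dots> \<le> p ^ a * (p ^ (a * j) * h (p ^ (a + u0)))"
      using Suc.IH by (simp add: ac_simps)
    also have "\<dots> = p ^ (a * Suc j) * h (p ^ (a + u0))" by (simp add: power_add)
    finally show ?case .
  qed simp
  \<comment> \<open>Chosen so that k1 times the initial value of \<open>h\<close> is j itself: after
    j rounds the comparison reads p^j \<le> j.\<close>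
  define j where "j = k1 * h (p ^ (a + u0))"
  have "p ^ (a * j) * p ^ j = p ^ (j * (a + 1))" by (simp add: power_add[symmetric] algebra_simps)
  also have "\<dots> \<le> p ^ (a + u0 + j * g)"
    using mult_left_mono[OF g(1), of j] \<open>2 \<le> p\<close> by (intro power_increasing) auto
  also have "\<dots> \<le> k1 * h (p ^ (a + u0 + j * g))"
  proof (rule h_lower)
    show "n0 + k1 \<le> p ^ (a + u0 + j * g)"
      using p_exp[of "a + u0 + j * g"] by (simp add: u0_def)
  qed
  also have "\<dots> \<le> p ^ (a * j) * j"
    using mult_left_mono[OF iterate[of j], of k1] by (simp add: j_def ac_simps)
  finally have "p ^ j \<le> j" using \<open>2 \<le> p\<close> by simp
  with p_exp[of j] show False by simp
qed

text \<open>A finite supremum of a nonempty set is attained, and a prime strictly below the bottom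
  of such a chain would extend it to length d + 1.\<close>

lemma maximal_prime_chain:
  assumes "krull_dim R = enat d" "0 < d"
  obtains P where "\<And>i. i \<le> d \<Longrightarrow> primeideal (P i) R" "\<And>i. i < d \<Longrightarrow> P i \<subset> P (Suc i)"
    "minimal_prime R (P 0)"
proof -
  define X where "X = {enat n |n. \<exists>P. (\<forall>i\<le>n. primeideal (P i) R) \<and> (\<forall>i<n. P i \<subset> P (Suc i))}"
  have Sup: "Sup X = enat d" using assms(1) by (simp add: X_def krull_dim_def)
  then have "finite X" "X \<noteq> {}" using \<open>0 < d\<close> by (auto simp: Sup_enat_def zero_enat_def split: if_splits)
  with Sup have "enat d \<in> X" using Max_in[of X] by (simp add: Sup_enat_def)
  then obtain P where P: "\<And>i. i \<le> d \<Longrightarrow> primeideal (P i) R" "\<And>i. i < d \<Longrightarrow> P i \<subset> P (Suc i)"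
    unfolding X_def by auto
  have "minimal_prime R (P 0)"
    unfolding minimal_prime_def
  proof (intro conjI allI impI P(1) le0)
    fix Q assume Q: "primeideal Q R \<and> Q \<subseteq> P 0"
    show "Q = P 0"
    proof (rule ccontr)
      assume "Q \<noteq> P 0"
      define P' where "P' = case_nat Q P"
      have "primeideal (P' i) R" if "i \<le> Suc d" for i
        using that Q P(1) by (cases i) (auto simp: P'_def)
      moreover have "P' i \<subset> P' (Suc i)" if "i < Suc d" for i
        using that Q \<open>Q \<noteq> P 0\<close> P(2) by (cases i) (auto simp: P'_def)
      ultimately have "enat (Suc d) \<in> X" unfolding X_def by blast
      then have "enat (Suc d) \<le> enat d" using Sup_upper Sup by metis
      then show False by simp
    qed
  qed
  with P that show thesis by blast
qed

section \<open>Length inequalities and monomial multipliers\<close>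

context noetherian_cring
begin

text \<open>Lengths modulo \<open>P + I\<^sup>M\<close>, \<open>M = Q + s\<close>, of the ideal generated by the \<open>Q\<close>-th powers: from
  below, each generator contributes at most the length of \<open>R / (P + I\<^sup>s)\<close>; from above, dividing
  by \<open>c\<close> loses only the length of \<open>R / (P + I\<^sup>M + c R)\<close>, which Artin-Rees controls.\<close>

lemma length_bound_of_colon:
  assumes P: "primeideal P R" and as: "set as \<subseteq> carrier R" and c: "c \<in> carrier R"
    and fin: "finite_length R (filt R P as 1) (carrier R)"
    and k: "\<And>n. colon R (filt R P as n) c \<subseteq> filt R P as (n - k)"
    and N: "\<And>\<alpha>. \<alpha> \<in> exps (length as) N \<Longrightarrow>
      c \<otimes> monomial R as \<alpha> \<in> Idl ((\<lambda>a. a [^] Q) ` set as)"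
  shows "len R (filt R P as (Q + s - k)) (carrier R) \<le>
    len R (filt R P as N) (carrier R) + length as * len R (filt R P as s) (carrier R)"
proof -
  define A where "A = filt R P as"
  define L where "L n = len R (A n) (carrier R)" for n
  have Pi: "ideal P R" using P by (rule primeideal.axioms(1))
  have A: "ideal (A n) R" "P \<subseteq> A n" "A n \<subseteq> carrier R" for n
    using filt_ideal[OF Pi as] filt_gens(1)[OF Pi as] ideal_subset_carrier by (auto simp: A_def)
  have finA: "finite_length R (A n) (carrier R)" for n
    unfolding A_def by (rule finite_length_filt[OF Pi as fin])
  define M where "M = Q + s"
  define S where "S = (\<lambda>a. a [^] Q) ` set as"
  define J where "J = Idl (A M \<union> S)"
  have S: "finite S" "S \<subseteq> carrier R" "card S \<le> length as"
    using as order_trans[OF card_image_le card_length, of as "\<lambda>a. a [^] Q"] by (auto simp: S_def)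
  have sub: "A M \<union> S \<subseteq> carrier R" using A S by auto
  have J: "ideal J R" "A M \<subseteq> J" "J \<subseteq> carrier R" "Idl S \<subseteq> J"
  proof -
    show id: "ideal J R" unfolding J_def by (rule genideal_ideal[OF sub])
    then show "J \<subseteq> carrier R" by (rule ideal_subset_carrier)
    show "A M \<subseteq> J" using genideal_self[OF sub] by (auto simp: J_def)
    show "Idl S \<subseteq> J" using genideal_self[OF sub] by (intro genideal_minimal id) (auto simp: J_def)
  qed
  have A_s: "A s \<subseteq> colon R (A M) b" if bS: "b \<in> S" for b
  proof -
    obtain a where a: "a \<in> set as" "b = a [^] Q" using bS by (auto simp: S_def)
    obtain \<epsilon> where \<epsilon>: "\<epsilon> \<in> exps (length as) 1" "monomial R as \<epsilon> = a"
      using monomial_unit[OF as a(1)] by blast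
    have "map (\<lambda>i. i * Q) \<epsilon> \<in> exps (length as) Q"
      using \<epsilon>(1) by (auto simp: exps_def sum_list_mult_const)
    then have "monomial R as (map (\<lambda>i. i * Q) \<epsilon>) \<in> A Q"
      using filt_gens(2)[OF Pi as] unfolding A_def by blast
    then have "b \<in> A Q" using monomial_scale[OF as, of \<epsilon> Q] \<epsilon> a by (simp add: exps_def)
    then show ?thesis
      using filt_mult[OF Pi as] subsetD[OF A(3)] unfolding A_def M_def by (auto simp: mem_colon)
  qed
  have 1: "len R (A M) J \<le> card S * L s"
    using len_adjoin_finite[OF A(1) S(1,2) finA A_s] by (simp add: J_def L_def)
  have finJ: "finite_length R J (carrier R)"
    using J by (intro finite_length_subinterval[OF finA[of M]] oneideal) auto
  \<comment> \<open>The multiplier hypothesis makes R/(J : c) a quotient of R modulo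
    \<open>A N\<close>.\<close>
  have "A N \<subseteq> colon R J c"
    unfolding A_def
  proof (rule filt_minimal[OF Pi as colon_ideal[OF J(1) c]])
    show "P \<subseteq> colon R J c"
      using A(2)[of M] J(2) c ideal.Icarr[OF Pi] ideal.I_l_closed[OF Pi]
      by (fastforce simp: mem_colon)
    show "monomial R as \<alpha> \<in> colon R J c" if "\<alpha> \<in> exps (length as) N" for \<alpha>
      using N[OF that] J(4) as by (auto simp: mem_colon S_def)
  qed
  then have 2: "len R (colon R J c) (carrier R) \<le> L N"
    unfolding L_def by (intro len_antimono finA colon_ideal J c ideal_subset_carrier)
  have ins: "insert c (A M) \<subseteq> carrier R" "insert c J \<subseteq> carrier R" using c A J by auto
  have "Idl (insert c (A M)) \<subseteq> Idl (insert c J)"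
    using J(2) ins by (intro subset_Idl_subset) auto
  moreover have "A M \<subseteq> Idl (insert c (A M))" using genideal_self[OF ins(1)] by auto
  ultimately have 3: "len R (Idl (insert c J)) (carrier R) \<le> len R (Idl (insert c (A M))) (carrier R)"
    using ins
    by (intro len_antimono finite_length_subinterval[OF finA[of M]] genideal_ideal oneideal
        ideal_subset_carrier[OF genideal_ideal]) auto
  have 4: "L (M - k) \<le> len R (colon R (A M) c) (carrier R)"
    unfolding L_def using k[of M] len_colon(2)[OF finA c] A
    by (intro len_antimono) (auto simp: A_def)
  have "L M = len R (A M) J + len R J (carrier R)"
    unfolding L_def by (intro len_add finA J)
  also have "len R J (carrier R) = len R (colon R J c) (carrier R) + len R (Idl (insert c J)) (carrier R)"
    by (rule len_colon(1)[OF finJ c])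
  finally have "L M \<le> card S * L s + L N + len R (Idl (insert c (A M))) (carrier R)"
    using 1 2 3 by linarith
  \<comment> \<open>Splitting the same length by c brings in the same cokernel R/(A M + cR), which
    therefore cancels.\<close>
  moreover have "L M = len R (colon R (A M) c) (carrier R) + len R (Idl (insert c (A M))) (carrier R)"
    unfolding L_def by (rule len_colon(1)[OF finA c])
  moreover have "card S * L s \<le> length as * L s" using S(3) by simp
  ultimately have "L (M - k) \<le> L N + length as * L s" using 4 by linarith
  then show ?thesis by (simp add: L_def A_def M_def)
qed

text \<open>Split R / (P + I^n) by multiplication by some x in P' but not in P. The colon part has
  at least the length of R / (P + I^(n - k)) by Artin-Rees; the cokernel surjects onto R / (P' +
  I^n), of length at least n because the filtration modulo P' is strict.\<close>

lemma length_superlinear: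
  assumes loc: "{J. maximalideal J R} = {\<mm>}" and P: "primeideal P R" and P': "primeideal P' R" "P \<subset> P'"
    and as: "set as \<subseteq> \<mm>" "\<not> set as \<subseteq> P'"
    and fin: "finite_length R (filt R P as 1) (carrier R)"
  obtains k where "\<And>n. n + len R (filt R P as (n - k)) (carrier R) \<le> len R (filt R P as n) (carrier R)"
proof -
  have m: "maximalideal \<mm> R" using loc by blast
  have asc: "set as \<subseteq> carrier R"
    using as(1) ideal_subset_carrier[OF maximalideal.axioms(1)[OF m]] by blast
  have Pi: "ideal P R" "ideal P' R" using P P' by (auto intro: primeideal.axioms(1))
  obtain x where x: "x \<in> P'" "x \<notin> P" using P'(2) by blast
  have xc: "x \<in> carrier R" using x ideal.Icarr[OF Pi(2)] by blast
  obtain k where k: "\<And>n. colon R (filt R P as n) x \<subseteq> filt R P as (n - k)"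
    using colon_filt_subset[OF P asc xc x(2)] by blast
  have finP: "finite_length R (filt R P as n) (carrier R)" for n
    by (rule finite_length_filt[OF Pi(1) asc fin])
  have "n + len R (filt R P as (n - k)) (carrier R) \<le> len R (filt R P as n) (carrier R)" for n
  proof -
    have "ideal_chain R (filt R P' as n) n (carrier R)"
    proof -
      have "ideal_chain R (filt R P' as n) (n - i) (filt R P' as i)" if "i \<le> n" for i
        using that
      proof (induction i rule: inc_induct)
        case base
        then show ?case using ideal_chain.start[OF filt_ideal[OF Pi(2) asc]] by simp
      next
        case (step i)
        have "ideal_chain R (filt R P' as n) (Suc (n - Suc i)) (filt R P' as i)"
          by (rule ideal_chain.strict[OF step.IH filt_strict[OF loc P'(1) as] filt_ideal[OF Pi(2) asc]])
        then show ?case using step.hyps by (simp add: Suc_diff_Suc)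
      qed
      from this[of 0] show ?thesis by (simp add: filt_0[OF Pi(2) asc])
    qed
    moreover have PP': "filt R P as n \<subseteq> filt R P' as n"
      using psubset_imp_subset[OF P'(2)] subsetD[OF filt_gens(1)[OF Pi(2) asc]]
        subsetD[OF filt_gens(2)[OF Pi(2) asc]]
      by (intro filt_minimal Pi asc filt_ideal) auto
    moreover have "finite_length R (filt R P' as n) (carrier R)"
      by (intro finite_length_subinterval[OF finP[of n]] filt_ideal Pi asc oneideal PP'
          ideal_subset_carrier order_refl)
    ultimately have 1: "n \<le> len R (filt R P' as n) (carrier R)" by (intro ideal_chain_le_len)
    have ins: "insert x (filt R P as n) \<subseteq> carrier R"
      using xc ideal_subset_carrier[OF filt_ideal[OF Pi(1) asc]] by simp
    have "Idl (insert x (filt R P as n)) \<subseteq> filt R P' as n"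
      using PP' x(1) filt_gens(1)[OF Pi(2) asc] by (intro genideal_minimal filt_ideal Pi asc) auto
    moreover have "filt R P as n \<subseteq> Idl (insert x (filt R P as n))" using genideal_self[OF ins] by auto
    ultimately have 2: "len R (filt R P' as n) (carrier R) \<le> len R (Idl (insert x (filt R P as n))) (carrier R)"
      by (intro len_antimono finite_length_subinterval[OF finP] genideal_ideal ins oneideal
          filt_ideal Pi asc ideal_subset_carrier) auto
    have "len R (filt R P as (n - k)) (carrier R) \<le> len R (colon R (filt R P as n) x) (carrier R)"
      using k[of n] len_colon(2)[OF finP xc]
      by (intro len_antimono filt_ideal Pi asc ideal_subset_carrier)
    with 1 2 len_colon(1)[OF finP[of n] xc] show ?thesis by linarith
  qed
  with that show thesis by blast
qed

text \<open>The multiplier in the definition of tight closure depends on the element; on a finite set of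
  elements a product of multipliers serves all of them.\<close>

lemma tight_closure_common_multiplier:
  assumes "minimal_prime R P" "\<aa> \<subseteq> carrier R" "finite X" "X \<subseteq> tight_closure p R \<aa>"
  shows "\<exists>c\<in>carrier R. c \<notin> P \<and>
    (\<forall>\<^sub>F n in sequentially. \<forall>x\<in>X. c \<otimes> x [^] (p ^ n) \<in> bracket_power R \<aa> (p ^ n))"
  using assms(3,4)
proof (induction X rule: finite_induct)
  case empty
  have P: "primeideal P R" using assms(1) by (simp add: minimal_prime_def)
  show ?case using one_notin_prime[OF P] by (intro bexI[of _ \<one>]) auto
next
  case (insert x X)
  have P: "primeideal P R" using assms(1) by (simp add: minimal_prime_def)
  have xc: "x \<in> carrier R" "X \<subseteq> carrier R" using insert.prems by (auto simp: tight_closure_def)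
  obtain c where c: "c \<in> carrier R" "c \<notin> P"
    "\<forall>\<^sub>F n in sequentially. \<forall>x\<in>X. c \<otimes> x [^] (p ^ n) \<in> bracket_power R \<aa> (p ^ n)"
    using insert by auto
  obtain c' where c': "c' \<in> carrier R" "c' \<notin> P"
    "\<forall>\<^sub>F n in sequentially. c' \<otimes> x [^] (p ^ n) \<in> bracket_power R \<aa> (p ^ n)"
    using insert.prems assms(1) by (auto simp: tight_closure_def)
  have cc: "c \<otimes> c' \<notin> P" using primeideal.I_prime[OF P c(1) c'(1)] c(2) c'(2) by blast
  have B: "ideal (bracket_power R \<aa> m) R" for m
    unfolding bracket_power_def using assms(2) by (intro genideal_ideal) auto
  have "\<forall>\<^sub>F n in sequentially. \<forall>y\<in>insert x X.
      (c \<otimes> c') \<otimes> y [^] (p ^ n) \<in> bracket_power R \<aa> (p ^ n)"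
    using c(3) c'(3)
  proof eventually_elim
    case (elim n)
    show ?case
    proof
      fix y assume y: "y \<in> insert x X"
      then have yc: "y [^] (p ^ n) \<in> carrier R" using xc by auto
      have "(c \<otimes> c') \<otimes> y [^] (p ^ n) = c \<otimes> (c' \<otimes> y [^] (p ^ n))"
        "(c \<otimes> c') \<otimes> y [^] (p ^ n) = c' \<otimes> (c \<otimes> y [^] (p ^ n))"
        using c(1) c'(1) yc by (simp_all add: m_ac)
      with y elim c(1) c'(1) ideal.I_l_closed[OF B]
      show "(c \<otimes> c') \<otimes> y [^] (p ^ n) \<in> bracket_power R \<aa> (p ^ n)" by (metis insertE)
    qed
  qed
  with cc c(1) c'(1) show ?case by (intro bexI[of _ "c \<otimes> c'"]) auto
qed

text \<open>Dividing an exponent by \<open>u\<close> with remainder loses less than one unit of degree per variable.\<close>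

lemma monomial_multiplier_extend:
  assumes as: "set as \<subseteq> carrier R" "as \<noteq> []" and c: "c \<in> carrier R" and J: "ideal J R"
    and u: "0 < (u::nat)"
    and mult: "\<And>\<alpha>. \<alpha> \<in> exps (length as) (q + 1) \<Longrightarrow> c \<otimes> monomial R as \<alpha> [^] u \<in> J"
    and \<beta>: "\<beta> \<in> exps (length as) ((q + length as) * u)"
  shows "c \<otimes> monomial R as \<beta> \<in> J"
proof -
  define \<gamma> where "\<gamma> = map (\<lambda>i. i div u) \<beta>"
  define \<delta> where "\<delta> = map (\<lambda>i. i mod u) \<beta>"
  have len: "length \<beta> = length as" "length \<gamma> = length as" "length \<delta> = length as"
    using \<beta> by (auto simp: exps_def \<gamma>_def \<delta>_def)
  have \<beta>_eq: "\<beta> = exp_add (map (\<lambda>i. i * u) \<gamma>) \<delta>"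
    unfolding \<gamma>_def \<delta>_def by (rule exp_add_div_mod[symmetric])
  have "q * u + length as \<le> u * sum_list \<gamma>"
    using sum_list_le_div[OF u, of \<beta>] \<beta> by (simp add: exps_def \<gamma>_def algebra_simps)
  moreover have "0 < length as" using as(2) by simp
  \<comment> \<open>A nonempty \<open>as\<close> makes this strict, giving \<gamma> degree at least
    q + 1 instead of q.\<close>
  ultimately have "u * q < u * sum_list \<gamma>" unfolding mult.commute[of q u] by linarith
  then have "q + 1 \<le> sum_list \<gamma>" by simp
  then obtain \<alpha> where \<alpha>: "exp_le \<alpha> \<gamma>" "sum_list \<alpha> = q + 1" by (rule exp_truncate)
  obtain \<eta> where \<eta>: "length \<eta> = length \<gamma>" "\<gamma> = exp_add \<alpha> \<eta>"
    using exp_le_imp_exp_add \<alpha>(1) by blast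
  have len': "length \<alpha> = length as" "length \<eta> = length as"
    using len(2) \<eta>(1) list_all2_lengthD[OF \<alpha>(1)] by simp_all
  have "monomial R as \<beta> = monomial R as \<gamma> [^] u \<otimes> monomial R as \<delta>"
    using \<beta>_eq monomial_add[OF as(1), of "map (\<lambda>i. i * u) \<gamma>" \<delta>] monomial_scale[OF as(1) len(2), of u] len
    by simp
  also have "monomial R as \<gamma> = monomial R as \<alpha> \<otimes> monomial R as \<eta>"
    unfolding \<eta>(2) by (rule monomial_add[OF as(1) len'])
  finally have "c \<otimes> monomial R as \<beta> =
      (c \<otimes> monomial R as \<alpha> [^] u) \<otimes> (monomial R as \<eta> [^] u \<otimes> monomial R as \<delta>)"
    using as(1) c by (simp add: nat_pow_distrib m_assoc)
  moreover have "c \<otimes> monomial R as \<alpha> [^] u \<in> J"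
    using \<alpha>(2) len' by (intro mult) (simp add: exps_def)
  ultimately show ?thesis using as(1) ideal.I_r_closed[OF J] by simp
qed

end

theorem theorem8p5:
  fixes R :: "('a, 'b) ring_scheme" and \<mm> I :: "'a set" and p d :: nat
  assumes "noetherian_ring R"
    and "local_ring R \<mm>"
    and "prime p"
    and "has_characteristic R p"
    and "F_finite p R"
    and "krull_dim R = enat d"
    and "d \<ge> 2"
    and "primary_to R \<mm> I"
  shows "\<exists>q\<^sub>0::nat. \<forall>q\<ge>q\<^sub>0. (\<exists>e. q = p ^ e) \<longrightarrow>
           \<not> I [^]\<^bsub>ideals_set R\<^esub> (q + 1) \<subseteq> tight_closure p R (bracket_power R I q)"
proof -
  interpret noetherian_cring R
    using assms(1,2) unfolding local_ring_def noetherian_cring_def by simp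
  have loc: "{J. maximalideal J R} = {\<mm>}" using assms(2) by (simp add: local_ring_def)
  then have m: "maximalideal \<mm> R" by blast
  have I: "ideal I R" and rad: "radical R I = \<mm>"
    using assms(8) by (auto simp: primary_to_def primary_ideal_def)
  have frob: "(\<lambda>x. x [^]\<^bsub>R\<^esub> p) \<in> ring_hom R R"
    using assms(5) by (simp add: F_finite_def finite_ring_hom_def)
  have p: "2 \<le> p" using assms(3) prime_ge_2_nat by blast
  obtain P where P: "\<And>i. i \<le> d \<Longrightarrow> primeideal (P i) R" "\<And>i. i < d \<Longrightarrow> P i \<subset> P (Suc i)"
    "minimal_prime R (P 0)"
    using maximal_prime_chain[OF assms(6)] assms(7) by auto
  have P012: "primeideal (P 0) R" "primeideal (P 1) R" "primeideal (P 2) R" "P 0 \<subset> P 1" "P 1 \<subset> P 2"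
    using P(1)[of 0] P(1)[of 1] P(1)[of 2] P(2)[of 0] P(2)[of 1] assms(7) by (auto simp: numeral_2_eq_2)
  have P0: "ideal (P 0) R" using P012(1) by (rule primeideal.axioms(1))
  obtain A where A: "A \<subseteq> carrier R" "finite A" "I = Idl\<^bsub>R\<^esub> A" using finetely_gen[OF I] by blast
  obtain as where "set as = A" using A(2) finite_list by blast
  \<comment> \<open>The extra generator 0 keeps the list nonempty and \<mu> positive.\<close>
  define gs where "gs = \<zero>\<^bsub>R\<^esub> # as"
  have gsA: "set gs = insert \<zero>\<^bsub>R\<^esub> A" by (simp add: gs_def \<open>set as = A\<close>)
  have gsc: "set gs \<subseteq> carrier R" using A(1) by (simp add: gsA)
  have gsI: "set gs \<subseteq> I" using A(3) genideal_self[OF A(1)] ideal_zero_mem[OF I] by (simp add: gsA)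
  have I_gs: "I = Idl\<^bsub>R\<^esub> (set gs)"
  proof (rule antisym)
    show "I \<subseteq> Idl\<^bsub>R\<^esub> (set gs)" unfolding A(3) using gsc by (intro subset_Idl_subset) (auto simp: gsA)
    show "Idl\<^bsub>R\<^esub> (set gs) \<subseteq> I" by (rule genideal_minimal[OF I gsI])
  qed
  have Im: "I \<subseteq> \<mm>"
  proof
    fix x assume "x \<in> I"
    moreover from this have "x \<in> carrier R" using ideal.Icarr[OF I] by blast
    ultimately show "x \<in> \<mm>" unfolding rad[symmetric] radical_def by (auto intro!: exI[of _ 1])
  qed
  \<comment> \<open>The third prime enters here: I inside \<open>P 1\<close> would force \<mm>, the
    radical of I, into \<open>P 1\<close>, leaving no room for \<open>P 2\<close>.\<close>
  have gs_P1: "\<not> set gs \<subseteq> P 1"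
  proof
    assume "set gs \<subseteq> P 1"
    then have "I \<subseteq> P 1"
      unfolding I_gs by (intro genideal_minimal primeideal.axioms(1)[OF P012(2)])
    then have mP1: "\<mm> \<subseteq> P 1"
      unfolding rad[symmetric] radical_def using prime_pow_mem[OF P012(2)] by blast
    have P2: "ideal (P 2) R" using P012(3) by (rule primeideal.axioms(1))
    have "P 2 = \<mm> \<or> P 2 = carrier R"
      using maximalideal.I_maximal[OF m P2] mP1 P012(5) ideal_subset_carrier[OF P2] by blast
    then show False using primeideal.I_notcarr[OF P012(3)] mP1 P012(5) by auto
  qed
  define B where "B = filt R (P 0) gs"
  have B: "ideal (B n) R" "B (Suc n) \<subseteq> B n" "B n \<subseteq> carrier R" for n
    using filt_ideal[OF P0 gsc] filt_antimono[OF P0 gsc, of n "Suc n"] ideal_subset_carrier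
    by (auto simp: B_def)
  have "I \<subseteq> B 1"
    unfolding I_gs B_def
  proof (rule genideal_minimal[OF filt_ideal[OF P0 gsc]])
    show "set gs \<subseteq> filt R (P 0) gs 1"
    proof
      fix a assume "a \<in> set gs"
      then obtain \<epsilon> where "\<epsilon> \<in> exps (length gs) 1" "monomial R gs \<epsilon> = a"
        using monomial_unit[OF gsc] by blast
      then show "a \<in> filt R (P 0) gs 1" using filt_gens(2)[OF P0 gsc] by blast
    qed
  qed
  then have fin1: "finite_length R (filt R (P 0) gs 1) (carrier R)"
    using B unfolding B_def
    by (intro finite_length_subinterval[OF finite_length_primary[OF loc I rad]] oneideal) auto
  have fin: "finite_length R (B n) (carrier R)" for n
    unfolding B_def by (rule finite_length_filt[OF P0 gsc fin1])
  define L where "L n = len R (B n) (carrier R)" for n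
  define h where "h n = len R (B (Suc n)) (B n)" for n
  have L: "L n = (\<Sum>j<n. h j)" for n
  proof (induction n)
    case 0
    show ?case using len_refl[OF oneideal] by (simp add: L_def B_def filt_0[OF P0 gsc])
  next
    case (Suc n)
    then show ?case using len_add[OF fin B(1,2,3), of n] by (simp add: L_def h_def)
  qed
  obtain n0 where n0: "\<And>n. n0 \<le> n \<Longrightarrow> h n \<le> h (Suc n)"
    using hilbert_function_eventually_mono[OF P0 gsc fin1] by (auto simp: h_def B_def)
  obtain k1 where k1: "\<And>n. n + L (n - k1) \<le> L n"
    using length_superlinear[OF loc P012(1,2,4) order_trans[OF gsI Im] gs_P1 fin1]
    unfolding L_def B_def by blast
  define \<mu> where "\<mu> = length gs"
  \<comment> \<open>This gives a < 2^a \<le> p^a for every p, so the bound p^(2a + 1) on q depends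
    on \<mu> and p alone.\<close>
  define a where "a = 2 * \<mu> + 2"
  have a: "2 * \<mu> + 2 \<le> p ^ a"
    using order.strict_trans2[OF less_exp power_mono[OF p, of a]] by (simp add: a_def)
  show ?thesis
  proof (intro exI[of _ "p ^ (2 * a + 1)"] allI impI notI)
    fix q assume q: "p ^ (2 * a + 1) \<le> q" "\<exists>e. q = p ^ e"
      and sub: "I [^]\<^bsub>ideals_set R\<^esub> (q + 1) \<subseteq> tight_closure p R (bracket_power R I q)"
    obtain f where f: "q = p ^ f" using q(2) by blast
    have "1 < p" using p by linarith
    from power_le_imp_le_exp[OF this q(1)[unfolded f]] have af: "2 * a + 1 \<le> f" .
    \<comment> \<open>The tight closure hypothesis is applied to these finitely many monomials only,
      so that a single multiplier c serves.\<close>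
    define X where "X = monomial R gs ` exps (length gs) (q + 1)"
    have bc: "bracket_power R I q \<subseteq> carrier R"
      unfolding bracket_power_def using ideal.Icarr[OF I]
      by (intro ideal_subset_carrier[OF genideal_ideal]) auto
    have "X \<subseteq> tight_closure p R (bracket_power R I q)"
    proof
      fix x assume "x \<in> X"
      then obtain \<alpha> where \<alpha>: "length \<alpha> = length gs" "sum_list \<alpha> = q + 1" "x = monomial R gs \<alpha>"
        by (auto simp: X_def exps_def)
      have "x \<in> I [^]\<^bsub>ideals_set R\<^esub> (q + 1)"
        using monomial_mem_ideals_pow[OF I gsI \<alpha>(1)] unfolding \<alpha>(2,3) .
      with sub show "x \<in> tight_closure p R (bracket_power R I q)" by blast
    qed
    then obtain c where c: "c \<in> carrier R" "c \<notin> P 0" and "\<forall>\<^sub>F n in sequentially. \<forall>x\<in>X.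
        c \<otimes>\<^bsub>R\<^esub> x [^]\<^bsub>R\<^esub> (p ^ n) \<in> bracket_power R (bracket_power R I q) (p ^ n)"
      using tight_closure_common_multiplier[OF P(3) bc, of X p] finite_exps by (auto simp: X_def)
    then obtain e0 where e0: "\<And>e x. e0 \<le> e \<Longrightarrow> x \<in> X \<Longrightarrow>
        c \<otimes>\<^bsub>R\<^esub> x [^]\<^bsub>R\<^esub> (p ^ e) \<in> bracket_power R (bracket_power R I q) (p ^ e)"
      unfolding eventually_sequentially by blast
    \<comment> \<open>This k depends on c and so on q, which is harmless: q is fixed and only u =
      p^e varies from here on.\<close>
    obtain k where k: "\<And>n. colon R (filt R (P 0) gs n) c \<subseteq> filt R (P 0) gs (n - k)"
      using colon_filt_subset[OF P012(1) gsc c] by blast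
    have bound: "L (p ^ f * p ^ e + s - k) \<le> L ((p ^ f + \<mu>) * p ^ e) + \<mu> * L s" if e: "e0 \<le> e" for e s
      unfolding L_def B_def \<mu>_def
    proof (rule length_bound_of_colon[OF P012(1) gsc c(1) fin1 k])
      let ?J = "Idl\<^bsub>R\<^esub> ((\<lambda>a. a [^]\<^bsub>R\<^esub> (p ^ f * p ^ e)) ` set gs)"
      fix \<beta> assume \<beta>: "\<beta> \<in> exps (length gs) ((p ^ f + length gs) * p ^ e)"
      show "c \<otimes>\<^bsub>R\<^esub> monomial R gs \<beta> \<in> ?J"
      proof (rule monomial_multiplier_extend[OF gsc _ c(1) _ _ _ \<beta>])
        show "ideal ?J R" using gsc by (intro genideal_ideal) auto
        fix \<alpha> assume "\<alpha> \<in> exps (length gs) (p ^ f + 1)"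
        then have "monomial R gs \<alpha> \<in> X" by (auto simp: X_def f)
        from e0[OF e this] show "c \<otimes>\<^bsub>R\<^esub> monomial R gs \<alpha> [^]\<^bsub>R\<^esub> (p ^ e) \<in> ?J"
          using bracket_power_iterate[OF frob _ gsc, of f e] p unfolding f I_gs by auto
      qed (use p gs_def in auto)
    qed
    show False
      by (rule growth_contradiction[of L h n0 k1 e0 k p f \<mu> a])
        (use L n0 k1 bound p a af in \<open>auto simp: \<mu>_def gs_def\<close>)
  qed
qed

end
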